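(* Let $N\ge2$ and consider the conformal limit $q_1=e^{-(N+\mathsf k)\hbar}$, $q_2=e^{\hbar}$, $\hbar\to0$, of the chiral cluster seed $\mathcal Q_N^{\mathrm{sub}}$, with the fields $c(z),d(z),\tilde\alpha_i(z)$ ($1\le i\le N-1$) identified in the leading terms of the vertex operators as in the context. Then the leading ($\hbar^0$) terms of the screening currents $\Psi_1^*(z)$ and $S_i^-(z)$ associated with the unfrozen vertices $1$ and $i=2,\dots,N$ reproduce the screening currents of the subregular W-algebra $\mathcal W^{\mathsf k,\mathrm{sub}}(\mathfrak{sl}(N))$ in the free field realization associated to the inverse Hamiltonian reduction: $$\Psi_1^{*,(0)}(z)=\Psi^{\mathrm{FMS}}(z)=e^{\frac12c+\frac12d}(z),\qquad S_i^{-,(0)}(z)=S^{\mathrm{sub}}_{i-1}(z)=e^{-\frac1{N+\mathsf k}\tilde\alpha_{i-1}}(z),\qquad i=2,\dots,N.$$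
   Context: **Fields.** $\mathsf k\neq-N$. For a vector space with symmetric bilinear form $\langle\cdot,\cdot\rangle$, modes satisfy $[x_n,y_m]=n\langle x,y\rangle\delta_{n+m,0}$, $[y_n,\hat x]=\langle x,y\rangle\delta_{n,0}$, $x(z)=\sum_{n\in\mathbb Z}x_nz^{-n-1}$, $e^x(z)=e^{\hat x}z^{x_0}e^{\sum_{n>0}\frac{z^n}nx_{-n}}e^{-\sum_{n>0}\frac{z^{-n}}nx_n}$. Let $c,d,\alpha_i$ ($1\le i\le N-1$) satisfy $\langle c,c\rangle=\langle d,d\rangle=0$, $\langle c,d\rangle=2$, $\langle\alpha_i,\alpha_j\rangle=(N+\mathsf k)A_{ij}$ with $A$ the Cartan matrix of $\mathfrak{sl}(N)$, $\langle\alpha_i,c\rangle=\langle\alpha_i,d\rangle=0$, and put $\tilde\alpha_1=\alpha_1-(N+\mathsf k)c$, $\tilde\alpha_i=\alpha_i$ for $i\ge2$. The algebra $\mathcal W^{\mathsf k,\mathrm{sub}}(\mathfrak{sl}(N))$ is (for generic $\mathsf k$) the intersection of kernels of the residues of the screening currents $S_1^{\mathrm{sub}}=e^{-\frac1{N+\mathsf k}\alpha_1+c}$, $S_i^{\mathrm{sub}}=e^{-\frac1{N+\mathsf k}\alpha_i}$ ($i\ge2$) and $\Psi^{\mathrm{FMS}}=e^{\frac12c+\frac12d}$. **Seed.** $q_1q_2q_3=1$, $q=q_2^{1/2}=e^{\hbar/2}$; $f^{[n]}$: replace $q,q_c$ and arrow labels by $n$-th powers. $\mathcal Q_N^{\mathrm{sub}}$: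 frozen $0$ (type $-$), frozen $N+1$ (type $+$), unfrozen $1,\dots,N$; arrows $i\to i+1$ (label $1$), $i+1\to i$ (label $q_3$) for $1\le i\le N-1$; loops of label $q_1$ at $i=2,\dots,N$; $1\to0$ (label $q_1$); $N+1\to1$ (label $1$); $N-1$ arrows $0\to N+1$ with labels $q_3,1,q_3^{-1},\dots,q_3^{3-N}$. Modes: $[x_{i,n},x_{j,m}]=\frac{\delta_{n+m,0}}nC_{ij}^{[n]}$ ($n>0$), $C_{ij}=(q-q^{-1})c_{ij}$, $c_{ii}=(q-q^{-1})-\sum_{\ell:i\to i}(q\kappa_\ell-q^{-1}\kappa_\ell^{-1})$ for unfrozen $i$, $c_{ii}=\mp q^{\mp1}$ for frozen $i$ of type $\pm$, $c_{ij}=\sum_{a:i\to j}q^{-1}\kappa_a^{-1}-\sum_{a:j\to i}q\kappa_a$ for $i\neq j$. Vertex operators $X_i(z)=X_ie^{\sum_{n>0}z^nx_{i,-n}}e^{\sum_{n>0}z^{-n}x_{i,n}}$, with zero modes (built from $[\hat p_a,\hat q_b]=\delta_{ab}$, $a,b=1,2$, $:\ :$ symmetric ordering) $X_0=:e^{-\hat q_1+\hat q_2}q^{-(N-1)\hat p_2}z^{-\hat p_1-\hat p_2}:$, $X_1=-q^{-2\hat p_1}$, $X_i=q^{2x_{i,0}}$ with $x_{i,0}$ commuting with these ($2\le i\le N$), $X_{N+1}=:e^{\hat q_1-\hat q_2}q^{-(N-1)\hat p_2}z^{\hat p_1+\hat p_2}:$. Central combinations of the $x_{i,n}$ are set to $0$.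 **Identification.** Modes are expanded in $\hbar$ in a realization on a fixed Heisenberg algebra, $f=\sum_{s\ge0}\hbar^sf^{(s)}$, with $X_0(z)=e^c(z)+O(\hbar)$, $X_1(z)=-1-\hbar\frac z2(c(z)+d(z))+O(\hbar^2)$, $X_i(z)=1+\hbar z\tilde\alpha_{i-1}(z)+O(\hbar^2)$ ($2\le i\le N$), $X_{N+1}(z)=e^{-c}(z)+O(\hbar)$; on zero modes $\hat c=-\hat q_1+\hat q_2$, $\hat d=-\hat q_1-\hat q_2$, $c_0=-\hat p_1-\hat p_2$, $d_0=-\hat p_1+\hat p_2$, $\tilde\alpha_{i,0}=x_{i+1,0}$. **Screening currents.** $\Psi_1^*(z)=:e^{-\hat q_1}z^{-\hat p_1}:e^{\sum_{n>0}z^n\frac{x_{1,-n}}{q^n-q^{-n}}}e^{-\sum_{n>0}z^{-n}\frac{x_{1,n}}{q^n-q^{-n}}}$. For $i\ge2$, with $\sigma=q_1^{1/2}$ and $s_{i,n}=x_{i,n}/(\sigma^n-\sigma^{-n})$, $S_i^-(z)=S_i^-z^{-s_{i,0}}e^{-\sum_{n>0}z^ns_{i,-n}}e^{-\sum_{n>0}z^{-n}s_{i,n}}$, with zero modes at leading order $S_i^-=e^{-\hat{\tilde\alpha}_{i-1}/(N+\mathsf k)}$, $s_{i,0}=\tilde\alpha_{i-1,0}/(N+\mathsf k)$.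
   Formalization: With symmetric ordering of the zero modes, the leading term of Ψ_1^* is z^{1/2}Ψ^FMS(z), not Ψ^FMS(z), since (c+d)/2 has norm 1; the formal theorem states this, and proves the displayed equality when e^{-q̂_1} is placed to the left of z^{-p̂_1}. *)

theory Defs
  imports
    "HOL-Library.Poly_Mapping"
    "HOL-Library.Multiset"
    "HOL-Library.Function_Algebras"
    "HOL-Computational_Algebra.Formal_Laurent_Series"
begin

section \<open>Fock space over formal Laurent series in \<open>\<hbar>\<close>\<close>

text \<open>
  The finite-dimensional space \<open>h\<close> carrying the bilinear form is \<open>'g \<Rightarrow> complex\<close> for a finite
  type \<open>'g\<close> (a basis), and the form is given by its Gram matrix \<open>G\<close>.  The Heisenberg algebra of
  \<open>h\<close> acts on \<open>\<Oplus>\<^sub>\<lambda> F\<^sub>\<lambda>\<close>, where \<open>\<lambda>\<close> runs over \<open>h\<close> and \<open>F\<^sub>\<lambda>\<close> has as basis the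
  monomials in the creation modes \<open>g\<^sub>-\<^sub>n\<close> (\<open>g :: 'g\<close>, \<open>n > 0\<close>) applied to the vacuum of weight
  \<open>\<lambda>\<close>; a monomial is the multiset of the pairs \<open>(g, n)\<close>.  Scalars are formal Laurent series in
  \<open>\<hbar>\<close> (so \<open>\<hbar>\<close> is \<open>fls_X\<close>), which makes it possible to divide by \<open>q\<^sup>n - q\<^sup>-\<^sup>n\<close>.
\<close>

type_synonym 'g vec = "'g \<Rightarrow> complex"
type_synonym 'g state = "'g vec \<times> ('g \<times> nat) multiset"
type_synonym 'g fock = "'g state \<Rightarrow>\<^sub>0 complex fls"

definition bil :: "('g::finite \<Rightarrow> 'g \<Rightarrow> complex) \<Rightarrow> 'g vec \<Rightarrow> 'g vec \<Rightarrow> complex" where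
  "bil G x y = (\<Sum>g\<in>UNIV. \<Sum>h\<in>UNIV. x g * G g h * y h)"

definition vscale :: "complex \<Rightarrow> 'g vec \<Rightarrow> 'g vec" (infixr "*\<^sub>v" 75) where
  "a *\<^sub>v x = (\<lambda>g. a * x g)"

definition smul :: "complex fls \<Rightarrow> 'g fock \<Rightarrow> 'g fock" where
  "smul a v = Poly_Mapping.map ((*) a) v"

definition ket :: "'g vec \<Rightarrow> ('g \<times> nat) multiset \<Rightarrow> 'g fock" where
  "ket l M = Poly_Mapping.single (l, M) 1"

definition lin :: "('g vec \<Rightarrow> ('g \<times> nat) multiset \<Rightarrow> 'g fock) \<Rightarrow> 'g fock \<Rightarrow> 'g fock" where
  "lin f v = (\<Sum>b\<in>Poly_Mapping.keys v. smul (Poly_Mapping.lookup v b) (f (fst b) (snd b)))"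

text \<open>
  \<open>mode G n y\<close> is the mode \<open>y\<^sub>n\<close>, for \<open>y\<close> in \<open>h\<close> with scalars extended to Laurent series.  The
  relation \<open>[x\<^sub>n, y\<^sub>m] = n \<langle>x, y\<rangle> \<delta>\<close> is realized by letting \<open>y\<^sub>n\<close>, \<open>n > 0\<close>, act as the
  derivation with \<open>g\<^sub>-\<^sub>n \<mapsto> n \<langle>y, g\<rangle>\<close>.
\<close>

definition mode :: "('g::finite \<Rightarrow> 'g \<Rightarrow> complex) \<Rightarrow> int \<Rightarrow> ('g \<Rightarrow> complex fls) \<Rightarrow> 'g fock \<Rightarrow> 'g fock" where
  "mode G n y = lin (\<lambda>l M.
     if n < 0 then \<Sum>g\<in>UNIV. smul (y g) (ket l (add_mset (g, nat (- n)) M))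
     else if n = 0 then smul (\<Sum>g\<in>UNIV. y g * fls_const (\<Sum>h\<in>UNIV. G g h * l h)) (ket l M)
     else \<Sum>g\<in>UNIV. smul (of_int n * of_nat (count M (g, nat n)) * (\<Sum>h\<in>UNIV. y h * fls_const (G h g)))
                         (ket l (M - {#(g, nat n)#})))"

definition cvec :: "'g vec \<Rightarrow> 'g \<Rightarrow> complex fls" where
  "cvec x = (\<lambda>g. fls_const (x g))"

text \<open>
  \<open>shift x\<close> is the operator \<open>exp x^\<close> (\<open>x^\<close> enters the formulas only through exponentials):
  \<open>[y\<^sub>n, x^] = \<langle>x, y\<rangle> \<delta>\<close> says that it maps \<open>F\<^sub>\<lambda>\<close> to \<open>F\<^sub>\<lambda>\<^sub>+\<^sub>x\<close> and commutes with
  all \<open>y\<^sub>n\<close>, \<open>n \<noteq> 0\<close>.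
\<close>

definition shift :: "'g vec \<Rightarrow> 'g fock \<Rightarrow> 'g fock" where
  "shift x = lin (\<lambda>l M. ket (l + x) M)"

definition diag :: "('g vec \<Rightarrow> complex fps) \<Rightarrow> 'g fock \<Rightarrow> 'g fock" where
  "diag e = lin (\<lambda>l M. smul (fps_to_fls (e l)) (ket l M))"

text \<open>\<open>qpow G y\<close> is \<open>q\<close> to the power \<open>y\<^sub>0\<close>, with \<open>q = exp (\<hbar>/2)\<close>.\<close>

definition qpow :: "('g::finite \<Rightarrow> 'g \<Rightarrow> complex) \<Rightarrow> 'g vec \<Rightarrow> 'g fock \<Rightarrow> 'g fock" where
  "qpow G y = diag (\<lambda>l. fps_exp (bil G y l / 2))"


section \<open>Formal fields\<close>

text \<open>
  A field is a formal series in \<open>z\<^sup>r (log z)\<^sup>j\<close> with \<open>r\<close> complex and \<open>j\<close> a natural number;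
  \<open>F (r, j)\<close> is the corresponding coefficient.  Logarithms occur only in expansions in \<open>\<hbar>\<close> of
  powers of \<open>z\<close> whose exponent depends on \<open>\<hbar>\<close>.
\<close>

type_synonym 'g field = "complex \<times> nat \<Rightarrow> 'g fock \<Rightarrow> 'g fock"

definition const_field :: "('g fock \<Rightarrow> 'g fock) \<Rightarrow> 'g field" where
  "const_field A = (\<lambda>(r, j) v. if r = 0 \<and> j = 0 then A v else 0)"

definition fscale :: "complex fls \<Rightarrow> 'g field \<Rightarrow> 'g field" where
  "fscale a F = (\<lambda>rj v. smul a (F rj v))"

definition zmul :: "complex \<Rightarrow> 'g field \<Rightarrow> 'g field" where
  "zmul a F = (\<lambda>(r, j). F (r - a, j))"

text \<open>\<open>y(z) = \<Sum>\<^sub>n y\<^sub>n z\<^sup>-\<^sup>n\<^sup>-\<^sup>1\<close>\<close>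

definition current :: "('g::finite \<Rightarrow> 'g \<Rightarrow> complex) \<Rightarrow> 'g vec \<Rightarrow> 'g field" where
  "current G y = (\<lambda>(r, j) v. if r \<in> \<int> \<and> j = 0 then mode G (- \<lfloor>Re r\<rfloor> - 1) (cvec y) v else 0)"

text \<open>
  \<open>zpow e\<close> is \<open>z\<close> to the power of the diagonal zero mode with eigenvalue \<open>e l\<close> on weight \<open>l\<close>:
  for \<open>e = e\<^sub>0 + \<hbar> e'\<close> it is \<open>z\<close> to the power \<open>e\<^sub>0\<close> times \<open>exp (\<hbar> e' log z)\<close>.
\<close>

definition zpow :: "('g vec \<Rightarrow> complex fps) \<Rightarrow> 'g field" where
  "zpow e = (\<lambda>(r, j). diag (\<lambda>l. if r = fps_nth (e l) 0
      then fps_const (1 / fact j) * (e l - fps_const r) ^ j else 0))"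

definition zero_mode :: "('g::finite \<Rightarrow> 'g \<Rightarrow> complex) \<Rightarrow> 'g vec \<Rightarrow> 'g vec \<Rightarrow> complex fps" where
  "zero_mode G y = (\<lambda>l. fps_const (bil G y l))"

text \<open>
  Two orderings of a product of \<open>exp x^\<close> and a function \<open>F\<close> of the zero modes \<open>y\<^sub>0\<close>.  Symmetric
  (Weyl) ordering splits \<open>exp x^\<close> into halves on both sides; e.g. the symmetric ordering of
  \<open>exp x^\<close> and \<open>exp y\<^sub>0\<close> is \<open>exp (x^ + y\<^sub>0)\<close>.  For \<open>F\<close> the power of \<open>z\<close> with exponent
  \<open>y\<^sub>0\<close> the two differ by the power of \<open>z\<close> with exponent \<open>\<langle>x, y\<rangle>/2\<close>.
\<close>

definition left_ordered :: "'g vec \<Rightarrow> 'g field \<Rightarrow> 'g field" where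
  "left_ordered x F = (\<lambda>rj v. shift x (F rj v))"

definition sym_ordered :: "'g vec \<Rightarrow> 'g field \<Rightarrow> 'g field" where
  "sym_ordered x F = (\<lambda>rj v. shift ((1/2) *\<^sub>v x) (F rj (shift ((1/2) *\<^sub>v x) v)))"

fun pow_coeff :: "(nat \<Rightarrow> 'g fock \<Rightarrow> 'g fock) \<Rightarrow> nat \<Rightarrow> nat \<Rightarrow> 'g fock \<Rightarrow> 'g fock" where
  "pow_coeff a 0 m v = (if m = 0 then v else 0)"
| "pow_coeff a (Suc i) m v = (\<Sum>n=1..m. a n (pow_coeff a i (m - n) v))"

text \<open>The coefficient of \<open>w\<^sup>m\<close> in \<open>exp (\<Sum>\<^sub>n\<^sub>>\<^sub>0 a\<^sub>n w\<^sup>n)\<close>.\<close>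

definition exp_coeff :: "(nat \<Rightarrow> 'g fock \<Rightarrow> 'g fock) \<Rightarrow> nat \<Rightarrow> 'g fock \<Rightarrow> 'g fock" where
  "exp_coeff a m v = (\<Sum>i\<le>m. smul (fls_const (1 / fact i)) (pow_coeff a i m v))"

text \<open>
  \<open>osc G y n\<close> is the coefficient of \<open>z\<^sup>n\<close> in
  \<open>exp (\<Sum>\<^sub>m\<^sub>>\<^sub>0 z\<^sup>m (y\<^sub>(\<^sub>-\<^sub>m\<^sub>))\<^sub>-\<^sub>m) exp (\<Sum>\<^sub>m\<^sub>>\<^sub>0 z\<^sup>-\<^sup>m (y\<^sub>(\<^sub>m\<^sub>))\<^sub>m)\<close>; on each vector only
  finitely many terms of the second factor are nonzero.
\<close>

definition osc :: "('g::finite \<Rightarrow> 'g \<Rightarrow> complex) \<Rightarrow> (int \<Rightarrow> 'g \<Rightarrow> complex fls) \<Rightarrow> int \<Rightarrow> 'g fock \<Rightarrow> 'g fock" where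
  "osc G y n v = Sum_any (\<lambda>i::nat. if n + int i \<ge> 0
     then exp_coeff (\<lambda>m. mode G (- int m) (y (- int m))) (nat (n + int i))
            (exp_coeff (\<lambda>m. mode G (int m) (y (int m))) i v)
     else 0)"

text \<open>Zero-mode factor \<open>Z\<close> times oscillator factor.\<close>

definition vertex :: "('g::finite \<Rightarrow> 'g \<Rightarrow> complex) \<Rightarrow> 'g field \<Rightarrow> (int \<Rightarrow> 'g \<Rightarrow> complex fls) \<Rightarrow> 'g field" where
  "vertex G Z y = (\<lambda>(r, j) v. Sum_any (\<lambda>n::int. Z (r - of_int n, j) (osc G y n v)))"

text \<open>\<open>e\<^sup>x(z)\<close>; both signs of the exponent are covered by \<open>- x\<^sub>n / n\<close>.\<close>

definition exp_field :: "('g::finite \<Rightarrow> 'g \<Rightarrow> complex) \<Rightarrow> 'g vec \<Rightarrow> 'g field" where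
  "exp_field G x = vertex G (left_ordered x (zpow (zero_mode G x)))
     (\<lambda>n. cvec ((- 1 / of_int n) *\<^sub>v x))"


section \<open>Expansion in \<open>\<hbar>\<close>\<close>

text \<open>The coefficient of \<open>\<hbar>\<^sup>s\<close>, as a (Laurent-series-linear) field with constant matrix elements.\<close>

definition hbar_term :: "int \<Rightarrow> 'g field \<Rightarrow> 'g field" where
  "hbar_term s F = (\<lambda>rj. lin (\<lambda>l M.
     Poly_Mapping.map (\<lambda>a. fls_const (fls_nth a s)) (F rj (ket l M))))"

text \<open>\<open>F = H + O(\<hbar>\<^sup>m)\<close>\<close>

definition eq_mod_hbar :: "int \<Rightarrow> 'g field \<Rightarrow> 'g field \<Rightarrow> bool" where
  "eq_mod_hbar m F H \<longleftrightarrow> (\<forall>s<m. hbar_term s F = hbar_term s H)"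

text \<open>\<open>F = \<Sum>\<^sub>s\<^sub>\<ge>\<^sub>0 \<hbar>\<^sup>s F\<^sup>(\<^sup>s\<^sup>)\<close>\<close>

definition hbar_expandable :: "'g field \<Rightarrow> bool" where
  "hbar_expandable F \<longleftrightarrow> (\<forall>s<0. hbar_term s F = 0)"


section \<open>Free fields of the subregular W-algebra\<close>

definition cartan :: "nat \<Rightarrow> nat \<Rightarrow> complex" where
  "cartan i j = (if i = j then 2 else if i = Suc j \<or> j = Suc i then - 1 else 0)"

definition sub_fields ::
  "('g::finite \<Rightarrow> 'g \<Rightarrow> complex) \<Rightarrow> nat \<Rightarrow> complex \<Rightarrow> 'g vec \<Rightarrow> 'g vec \<Rightarrow> (nat \<Rightarrow> 'g vec) \<Rightarrow> bool" where
  "sub_fields G N k c d \<alpha> \<longleftrightarrow>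
     (\<forall>g h. G g h = G h g) \<and>
     bil G c c = 0 \<and> bil G d d = 0 \<and> bil G c d = 2 \<and>
     (\<forall>i\<in>{1..N-1}. \<forall>j\<in>{1..N-1}. bil G (\<alpha> i) (\<alpha> j) = (of_nat N + k) * cartan i j) \<and>
     (\<forall>i\<in>{1..N-1}. bil G (\<alpha> i) c = 0 \<and> bil G (\<alpha> i) d = 0)"

definition tilde :: "nat \<Rightarrow> complex \<Rightarrow> 'g vec \<Rightarrow> (nat \<Rightarrow> 'g vec) \<Rightarrow> nat \<Rightarrow> 'g vec" where
  "tilde N k c \<alpha> i = (if i = 1 then \<alpha> 1 - (of_nat N + k) *\<^sub>v c else \<alpha> i)"

definition S_sub ::
  "('g::finite \<Rightarrow> 'g \<Rightarrow> complex) \<Rightarrow> nat \<Rightarrow> complex \<Rightarrow> 'g vec \<Rightarrow> (nat \<Rightarrow> 'g vec) \<Rightarrow> nat \<Rightarrow> 'g field" where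
  "S_sub G N k c \<alpha> i = exp_field G
     (if i = 1 then (- 1 / (of_nat N + k)) *\<^sub>v \<alpha> 1 + c else (- 1 / (of_nat N + k)) *\<^sub>v \<alpha> i)"

definition Psi_FMS :: "('g::finite \<Rightarrow> 'g \<Rightarrow> complex) \<Rightarrow> 'g vec \<Rightarrow> 'g vec \<Rightarrow> 'g field" where
  "Psi_FMS G c d = exp_field G ((1/2) *\<^sub>v c + (1/2) *\<^sub>v d)"


section \<open>The chiral cluster seed\<close>

text \<open>An arrow \<open>(i, j, a, b)\<close> goes from \<open>i\<close> to \<open>j\<close> and has label \<open>q\<^sub>1\<^sup>a q\<^sub>3\<^sup>b\<close>.\<close>

type_synonym arrow = "nat \<times> nat \<times> int \<times> int"

definition sub_arrows :: "nat \<Rightarrow> arrow list" where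
  "sub_arrows N =
     [(i, i + 1, 0, 0). i \<leftarrow> [1..<N]] @ [(i + 1, i, 0, 1). i \<leftarrow> [1..<N]] @
     [(i, i, 1, 0). i \<leftarrow> [2..<N+1]] @
     [(1, 0, 1, 0), (N + 1, 1, 0, 0)] @
     [(0, N + 1, 0, 1 - int j). j \<leftarrow> [0..<N-1]]"

text \<open>
  The \<open>n\<close>-th powers of \<open>q = q\<^sub>2\<^sup>1\<^sup>/\<^sup>2\<close>, of a label, and of \<open>\<sigma> = q\<^sub>1\<^sup>1\<^sup>/\<^sup>2\<close> in the
  conformal limit \<open>q\<^sub>1 = exp (- (N + k) \<hbar>)\<close>, \<open>q\<^sub>2 = exp \<hbar>\<close>,
  \<open>q\<^sub>3 = 1 / (q\<^sub>1 q\<^sub>2) = exp ((N + k - 1) \<hbar>)\<close>.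
\<close>

definition qn :: "int \<Rightarrow> complex fps" where
  "qn n = fps_exp (of_int n / 2)"

definition label_n :: "nat \<Rightarrow> complex \<Rightarrow> int \<Rightarrow> arrow \<Rightarrow> complex fps" where
  "label_n N k n = (\<lambda>(i, j, a, b).
     fps_exp (of_int n * (of_int a * - (of_nat N + k) + of_int b * (of_nat N + k - 1))))"

definition sigma_n :: "nat \<Rightarrow> complex \<Rightarrow> int \<Rightarrow> complex fps" where
  "sigma_n N k n = fps_exp (- (of_nat N + k) * of_int n / 2)"

definition arrows_between :: "nat \<Rightarrow> nat \<Rightarrow> nat \<Rightarrow> arrow list" where
  "arrows_between N i j = filter (\<lambda>(s, t, _). s = i \<and> t = j) (sub_arrows N)"

text \<open>\<open>c\<^sub>i\<^sub>j\<close> and \<open>C\<^sub>i\<^sub>j\<close> with \<open>q\<close> and all labels replaced by their \<open>n\<close>-th powers; the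
  frozen vertices \<open>0\<close> and \<open>N + 1\<close> have types \<open>-\<close> and \<open>+\<close>.\<close>

definition c_mat :: "nat \<Rightarrow> complex \<Rightarrow> int \<Rightarrow> nat \<Rightarrow> nat \<Rightarrow> complex fps" where
  "c_mat N k n i j =
     (if i = j then
        if i = 0 then qn n
        else if i = N + 1 then - qn (- n)
        else (qn n - qn (- n)) -
          (\<Sum>a\<leftarrow>arrows_between N i i. qn n * label_n N k n a - qn (- n) * label_n N k (- n) a)
      else (\<Sum>a\<leftarrow>arrows_between N i j. qn (- n) * label_n N k (- n) a) -
           (\<Sum>a\<leftarrow>arrows_between N j i. qn n * label_n N k n a))"

definition C_mat :: "nat \<Rightarrow> complex \<Rightarrow> int \<Rightarrow> nat \<Rightarrow> nat \<Rightarrow> complex fps" where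
  "C_mat N k n i j = (qn n - qn (- n)) * c_mat N k n i j"

text \<open>
  Realization of the seed modes on the fixed Heisenberg algebra: \<open>x i n\<close> is an element of
  \<open>h[[\<hbar>]]\<close> and the seed mode \<open>x\<^sub>i\<^sub>,\<^sub>n\<close> (\<open>n \<noteq> 0\<close>) is the operator \<open>seed_mode G x i n\<close>.
\<close>

type_synonym 'g modes = "nat \<Rightarrow> int \<Rightarrow> 'g \<Rightarrow> complex fps"

definition fvec :: "('g \<Rightarrow> complex fps) \<Rightarrow> 'g \<Rightarrow> complex fls" where
  "fvec y = (\<lambda>g. fps_to_fls (y g))"

definition seed_mode :: "('g::finite \<Rightarrow> 'g \<Rightarrow> complex) \<Rightarrow> 'g modes \<Rightarrow> nat \<Rightarrow> int \<Rightarrow> 'g fock \<Rightarrow> 'g fock" where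
  "seed_mode G x i n = mode G n (fvec (x i n))"

definition seed_relations :: "('g::finite \<Rightarrow> 'g \<Rightarrow> complex) \<Rightarrow> nat \<Rightarrow> complex \<Rightarrow> 'g modes \<Rightarrow> bool" where
  "seed_relations G N k x \<longleftrightarrow>
     (\<forall>i\<le>N+1. \<forall>j\<le>N+1. \<forall>n>0. \<forall>m. m \<noteq> 0 \<longrightarrow> (\<forall>v.
        seed_mode G x i n (seed_mode G x j m v) - seed_mode G x j m (seed_mode G x i n v) =
        (if n + m = 0 then smul (fps_to_fls (C_mat N k n i j) / of_int n) v else 0)))"

definition central_zero :: "('g::finite \<Rightarrow> 'g \<Rightarrow> complex) \<Rightarrow> nat \<Rightarrow> 'g modes \<Rightarrow> bool" where
  "central_zero G N x \<longleftrightarrow>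
     (\<forall>n u. n \<noteq> 0 \<longrightarrow>
        (let y = (\<lambda>v. \<Sum>i\<le>N+1. smul (u i) (seed_mode G x i n v)) in
         (\<forall>j\<le>N+1. \<forall>m. m \<noteq> 0 \<longrightarrow> (\<forall>v. y (seed_mode G x j m v) = seed_mode G x j m (y v)))
         \<longrightarrow> (\<forall>v. y v = 0)))"

text \<open>
  Zero-mode factors of the \<open>X\<^sub>i(z)\<close>.  The vectors \<open>p 1\<close>, \<open>p 2\<close>, \<open>q 1\<close>, \<open>q 2\<close> of \<open>h\<close> are those
  whose \<open>0\<close>-th modes are the \<open>p^\<^sub>a\<close> and whose hats are the \<open>q^\<^sub>a\<close>; \<open>xz i\<close> is the vector whose
  \<open>0\<close>-th mode is \<open>x\<^sub>i\<^sub>+\<^sub>1\<^sub>,\<^sub>0\<close>.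
\<close>

definition X_zero ::
  "('g::finite \<Rightarrow> 'g \<Rightarrow> complex) \<Rightarrow> nat \<Rightarrow> (nat \<Rightarrow> 'g vec) \<Rightarrow> (nat \<Rightarrow> 'g vec) \<Rightarrow> (nat \<Rightarrow> 'g vec) \<Rightarrow> nat \<Rightarrow> 'g field" where
  "X_zero G N p q xz i =
     (if i = 0 then
        sym_ordered (- q 1 + q 2)
          (\<lambda>rj v. qpow G ((- (of_nat N - 1)) *\<^sub>v p 2) (zpow (zero_mode G (- p 1 - p 2)) rj v))
      else if i = 1 then const_field (\<lambda>v. - qpow G ((- 2) *\<^sub>v p 1) v)
      else if i = N + 1 then
        sym_ordered (q 1 - q 2)
          (\<lambda>rj v. qpow G ((- (of_nat N - 1)) *\<^sub>v p 2) (zpow (zero_mode G (p 1 + p 2)) rj v))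
      else const_field (qpow G (2 *\<^sub>v xz (i - 1))))"

definition X_field ::
  "('g::finite \<Rightarrow> 'g \<Rightarrow> complex) \<Rightarrow> nat \<Rightarrow> (nat \<Rightarrow> 'g vec) \<Rightarrow> (nat \<Rightarrow> 'g vec) \<Rightarrow> (nat \<Rightarrow> 'g vec) \<Rightarrow>
   'g modes \<Rightarrow> nat \<Rightarrow> 'g field" where
  "X_field G N p q xz x i = vertex G (X_zero G N p q xz i) (\<lambda>n. fvec (x i n))"


section \<open>Screening currents of the seed\<close>

text \<open>\<open>\<Psi>\<^sub>1\<^sup>*(z)\<close> with zero-mode factor \<open>Z\<close>; as for \<open>exp_field\<close>, one formula covers both signs of
  \<open>n\<close>, since \<open>q\<^sup>n - q\<^sup>-\<^sup>n\<close> is odd in \<open>n\<close>.\<close>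

definition Psi_star :: "('g::finite \<Rightarrow> 'g \<Rightarrow> complex) \<Rightarrow> 'g field \<Rightarrow> 'g modes \<Rightarrow> 'g field" where
  "Psi_star G Z x = vertex G Z
     (\<lambda>n g. - (fvec (x 1 n) g / fps_to_fls (qn n - qn (- n))))"

definition s_modes :: "nat \<Rightarrow> complex \<Rightarrow> 'g modes \<Rightarrow> nat \<Rightarrow> int \<Rightarrow> 'g \<Rightarrow> complex fls" where
  "s_modes N k x i n = (\<lambda>g. fvec (x i n) g / fps_to_fls (sigma_n N k n - sigma_n N k (- n)))"

text \<open>
  \<open>S\<^sub>i\<^sup>-(z)\<close>, where \<open>A\<close> is the zero-mode operator \<open>S\<^sub>i\<^sup>-\<close> and \<open>e\<close> gives the eigenvalues of
  \<open>s\<^sub>i\<^sub>,\<^sub>0\<close> on the weight spaces.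
\<close>

definition S_minus ::
  "('g::finite \<Rightarrow> 'g \<Rightarrow> complex) \<Rightarrow> nat \<Rightarrow> complex \<Rightarrow> ('g fock \<Rightarrow> 'g fock) \<Rightarrow> ('g vec \<Rightarrow> complex fps) \<Rightarrow>
   'g modes \<Rightarrow> nat \<Rightarrow> 'g field" where
  "S_minus G N k A e x i = vertex G (\<lambda>rj v. A (zpow (\<lambda>l. - e l) rj v))
     (\<lambda>n g. - s_modes N k x i n g)"

definition zero_mode_operator :: "('g::finite \<Rightarrow> 'g \<Rightarrow> complex) \<Rightarrow> ('g fock \<Rightarrow> 'g fock) \<Rightarrow> bool" where
  "zero_mode_operator G A \<longleftrightarrow>
     (\<forall>v w. A (v + w) = A v + A w) \<and> (\<forall>a v. A (smul a v) = smul a (A v)) \<and>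
     (\<forall>n y v. n \<noteq> 0 \<longrightarrow> A (mode G n y v) = mode G n y (A v))"

end

theory Submission
  imports Defs
begin

text \<open>
  The hypotheses on the expansions of \<open>X\<^sub>1(z), \<dots>, X\<^sub>N(z)\<close> determine the action of the modes
  \<open>x\<^sub>i\<^sub>,\<^sub>n\<close> to first order in \<open>\<hbar>\<close>: between the vacuum and a one-particle state the exponential
  contributes only its linear term, so \<open>x\<^sub>i\<^sub>,\<^sub>n = \<hbar> a\<^sub>n + O(\<hbar>\<^sup>2)\<close> with \<open>a = (c + d)/2\<close> for
  \<open>i = 1\<close> and \<open>a\<close> the shifted simple root for \<open>i \<ge> 2\<close>.  The denominators \<open>q\<^sup>n - q\<^sup>-\<^sup>n\<close> and
  \<open>\<sigma>\<^sup>n - \<sigma>\<^sup>-\<^sup>n\<close> are \<open>n \<hbar>\<close> and \<open>- (N + k) n \<hbar>\<close> to first order.  So the modes of the screening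
  currents are regular at \<open>\<hbar> = 0\<close>, with the modes of the free-field exponentials as values, and
  setting \<open>\<hbar> = 0\<close> is compatible with the products and locally finite sums that make up a vertex
  operator.
\<close>

section \<open>Linear operators and locally finite sums on the Fock space\<close>

lemma lookup_smul [simp]: "Poly_Mapping.lookup (smul a v) b = a * Poly_Mapping.lookup v b"
  by (simp add: smul_def Poly_Mapping.map.rep_eq when_def)

interpretation fock: module smul
  by standard (auto intro!: poly_mapping_eqI simp: lookup_add algebra_simps)

abbreviation fock_linear :: "('g fock \<Rightarrow> 'g fock) \<Rightarrow> bool" where
  "fock_linear \<equiv> module_hom smul smul"

lemma fock_linearI:
  assumes "\<And>v w. A (v + w) = A v + A w" "\<And>a v. A (smul a v) = smul a (A v)"
  shows "fock_linear A"
  using assms by (simp add: module_hom_iff fock.module_axioms)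

text \<open>States outside the support contribute zero, so two vectors can be expanded over one
  common finite set of states. This is what makes sums and limits of vectors comparable term by
  term.\<close>

lemma lin_superset:
  assumes "finite S" "Poly_Mapping.keys v \<subseteq> S"
  shows "lin f v = (\<Sum>b\<in>S. smul (Poly_Mapping.lookup v b) (f (fst b) (snd b)))"
  unfolding lin_def using assms
  by (intro sum.mono_neutral_left) (auto simp: in_keys_iff)

lemma linear_lin: "fock_linear (lin f)"
proof (rule fock_linearI)
  fix v w :: "'a fock" and a
  let ?S = "Poly_Mapping.keys v \<union> Poly_Mapping.keys w"
  have "lin f (v + w) = (\<Sum>b\<in>?S. smul (Poly_Mapping.lookup (v + w) b) (f (fst b) (snd b)))"
    by (rule lin_superset) (simp_all add: Poly_Mapping.keys_add)
  then show "lin f (v + w) = lin f v + lin f w"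
    by (simp add: lin_superset[of ?S] lookup_add fock.scale_left_distrib sum.distrib)
  have "lin f (smul a v) = (\<Sum>b\<in>Poly_Mapping.keys v. smul (Poly_Mapping.lookup (smul a v) b) (f (fst b) (snd b)))"
    by (rule lin_superset) (auto simp: in_keys_iff)
  then show "lin f (smul a v) = smul a (lin f v)"
    by (simp add: lin_def fock.scale_sum_right)
qed

lemma lin_ket [simp]: "lin f (ket l M) = f l M"
  by (simp add: lin_def ket_def)

lemma lookup_ket: "Poly_Mapping.lookup (ket l M) b = (if b = (l, M) then 1 else 0)"
  by (auto simp: ket_def lookup_single when_def)

lemma lookup_lin:
  "Poly_Mapping.lookup (lin f v) b =
     (\<Sum>b'\<in>Poly_Mapping.keys v. Poly_Mapping.lookup v b' * Poly_Mapping.lookup (f (fst b') (snd b')) b)"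
  by (simp add: lin_def lookup_sum)

lemma ket_expansion: "v = lin ket v"
  by (rule poly_mapping_eqI)
     (auto simp: lookup_lin lookup_ket if_distrib in_keys_iff cong: if_cong)

lemma fock_linear_eq_lin:
  assumes "fock_linear A"
  shows "A v = lin (\<lambda>l M. A (ket l M)) v"
proof -
  interpret module_hom smul smul A by fact
  have "A v = A (lin ket v)" by (simp flip: ket_expansion)
  then show ?thesis by (simp add: lin_def sum scale)
qed

lemma fock_linear_eqI:
  assumes "fock_linear A" "fock_linear B" "\<And>l M. A (ket l M) = B (ket l M)"
  shows "A = B"
proof
  fix v
  have "A v = lin (\<lambda>l M. A (ket l M)) v"
    by (rule fock_linear_eq_lin) fact
  also have "\<dots> = B v"
    unfolding assms(3) by (rule fock_linear_eq_lin [symmetric]) fact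
  finally show "A v = B v" .
qed

lemma fock_linear_eq_at:
  assumes "fock_linear A" "fock_linear B" "\<And>l M. A (ket l M) = B (ket l M)"
  shows "A v = B v"
  using fock_linear_eqI[OF assms] by simp

lemma fock_linear_ident: "fock_linear (\<lambda>v. v)"
  by (rule fock_linearI) simp_all

lemma fock_linear_zero: "fock_linear (\<lambda>v. 0)"
  by (rule fock_linearI) simp_all

lemma fock_linear_compose:
  assumes "fock_linear A" "fock_linear B"
  shows "fock_linear (\<lambda>v. A (B v))"
  using assms by (simp add: module_hom_iff)

lemma fock_linear_smul: "fock_linear A \<Longrightarrow> fock_linear (\<lambda>v. smul a (A v))"
  by (auto simp: module_hom_iff fock.scale_right_distrib mult.commute)

lemma fock_linear_sum:
  assumes "\<And>i. i \<in> I \<Longrightarrow> fock_linear (A i)"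
  shows "fock_linear (\<lambda>v. \<Sum>i\<in>I. A i v)"
  by (rule fock_linearI)
     (use assms in \<open>auto simp: module_hom_iff sum.distrib fock.scale_sum_right intro!: sum.cong\<close>)

text \<open>A vector involves finitely many kets, so the indices that act on it lie in a finite
  union of the index sets of those kets.\<close>

lemma locally_finite_of_kets:
  fixes A :: "'i \<Rightarrow> 'g fock \<Rightarrow> 'g fock"
  assumes "\<And>i. fock_linear (A i)" "\<And>l M. finite {i. A i (ket l M) \<noteq> 0}"
  shows "finite {i. A i v \<noteq> 0}"
proof (rule finite_subset)
  let ?U = "\<Union>b\<in>Poly_Mapping.keys v. {i. A i (ket (fst b) (snd b)) \<noteq> 0}"
  have "A i v = 0" if "i \<notin> ?U" for i
  proof -
    have "A i v = lin (\<lambda>l M. A i (ket l M)) v"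
      by (rule fock_linear_eq_lin) (rule assms)
    also have "\<dots> = 0"
      unfolding lin_def using that by (intro sum.neutral) auto
    finally show ?thesis .
  qed
  then show "{i. A i v \<noteq> 0} \<subseteq> ?U" by blast
qed (use assms in auto)

text \<open>\<open>Sum_any\<close> takes the default value 0 on infinite support, which would
  destroy additivity; local finiteness, tested on kets, rules this out.\<close>

lemma fock_linear_Sum_any:
  fixes A :: "'i \<Rightarrow> 'g fock \<Rightarrow> 'g fock"
  assumes "\<And>i. fock_linear (A i)" "\<And>l M. finite {i. A i (ket l M) \<noteq> 0}"
  shows "fock_linear (\<lambda>v. Sum_any (\<lambda>i. A i v))"
proof (rule fock_linearI)
  note fin = locally_finite_of_kets[of A, OF assms]
  fix v w :: "'g fock" and a
  have lin: "A i (v + w) = A i v + A i w" "A i (smul a v) = smul a (A i v)" for i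
    using assms(1)[of i] by (simp_all add: module_hom_iff)
  show "Sum_any (\<lambda>i. A i (v + w)) = Sum_any (\<lambda>i. A i v) + Sum_any (\<lambda>i. A i w)"
    unfolding lin by (rule Sum_any.distrib) (rule fin)+
  have "Sum_any (\<lambda>i. A i (smul a v)) = (\<Sum>i | A i v \<noteq> 0. smul a (A i v))"
    unfolding lin by (rule Sum_any.expand_superset) (auto simp: fin)
  then show "Sum_any (\<lambda>i. A i (smul a v)) = smul a (Sum_any (\<lambda>i. A i v))"
    by (simp add: Sum_any.expand_set fock.scale_sum_right)
qed

lemma fock_linear_mode: "fock_linear (mode G n y)"
  unfolding mode_def by (rule linear_lin)

lemma fock_linear_shift: "fock_linear (shift x)"
  unfolding shift_def by (rule linear_lin)

lemma fock_linear_diag: "fock_linear (diag e)"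
  unfolding diag_def by (rule linear_lin)

lemma fock_linear_zpow: "fock_linear (zpow e rj)"
  unfolding zpow_def by (auto simp: fock_linear_diag split: prod.split)

lemma fock_linear_pow_coeff:
  assumes "\<And>n. fock_linear (a n)"
  shows "fock_linear (pow_coeff a i m)"
proof (induction i arbitrary: m)
  case 0
  then show ?case by (cases "m = 0") (simp_all add: fock_linear_ident fock_linear_zero)
next
  case (Suc i)
  have "fock_linear (\<lambda>v. \<Sum>n=1..m. a n (pow_coeff a i (m - n) v))"
    by (intro fock_linear_sum fock_linear_compose[OF assms Suc.IH])
  then show ?case by simp
qed

lemma fock_linear_exp_coeff:
  assumes "\<And>n. fock_linear (a n)"
  shows "fock_linear (exp_coeff a m)"
proof -
  have "fock_linear (\<lambda>v. \<Sum>i\<le>m. smul (fls_const (1 / fact i)) (pow_coeff a i m v))"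
    by (intro fock_linear_sum fock_linear_smul fock_linear_pow_coeff assms)
  then show ?thesis by (simp flip: exp_coeff_def)
qed

section \<open>Gradings of the Fock space\<close>

text \<open>A homogeneous subspace is encoded by the set of basis states that span it, so one notion
  serves both for the weight and for the energy and particle number.\<close>

definition supported :: "'g state set \<Rightarrow> 'g fock \<Rightarrow> bool" where
  "supported P v \<longleftrightarrow> Poly_Mapping.keys v \<subseteq> P"

lemma supported_zero [simp]: "supported P 0"
  by (simp add: supported_def)

lemma supported_empty: "supported {} v \<longleftrightarrow> v = 0"
  by (simp add: supported_def)

lemma supported_ket: "supported P (ket l M) \<longleftrightarrow> (l, M) \<in> P"
  by (simp add: supported_def ket_def)

lemma supported_smul: "supported P v \<Longrightarrow> supported P (smul a v)"
  by (auto simp: supported_def in_keys_iff)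

lemma supported_sum: "(\<And>i. i \<in> I \<Longrightarrow> supported P (f i)) \<Longrightarrow> supported P (sum f I)"
  unfolding supported_def using Poly_Mapping.keys_sum[of f I] by fast

lemma supported_Sum_any: "(\<And>i. supported P (f i)) \<Longrightarrow> supported P (Sum_any f)"
  by (simp add: Sum_any.expand_set supported_sum)

lemma supported_lin:
  assumes "supported Q v" "\<And>l M. (l, M) \<in> Q \<Longrightarrow> supported P (f l M)"
  shows "supported P (lin f v)"
  unfolding lin_def
proof (intro supported_sum supported_smul)
  fix b assume "b \<in> Poly_Mapping.keys v"
  then show "supported P (f (fst b) (snd b))"
    using assms by (cases b) (auto simp: supported_def)
qed

lemma lookup_not_supported: "supported P v \<Longrightarrow> b \<notin> P \<Longrightarrow> Poly_Mapping.lookup v b = 0"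
  by (auto simp: supported_def in_keys_iff)

definition energy :: "('g \<times> nat) multiset \<Rightarrow> nat" where
  "energy M = (\<Sum>p\<in>#M. snd p)"

lemma energy_empty [simp]: "energy {#} = 0"
  and energy_add_mset [simp]: "energy (add_mset p M) = snd p + energy M"
  by (simp_all add: energy_def)

text \<open>The degrees are integers, so that lowering them never truncates: an operator that would
  lower a degree below 0 lands in an empty set of states and hence gives 0.\<close>

definition graded :: "'g vec \<Rightarrow> int \<Rightarrow> int \<Rightarrow> 'g state set" where
  "graded l e s = {(l', M). l' = l \<and> int (energy M) = e \<and> int (size M) = s}"

definition weight_space :: "'g vec \<Rightarrow> 'g state set" where
  "weight_space l = {b. fst b = l}"

lemma graded_negative: "e < 0 \<or> s < 0 \<Longrightarrow> graded l e s = {}"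
  by (auto simp: graded_def)

lemma ket_in_graded: "(l, M) \<in> graded l (int (energy M)) (int (size M))"
  by (simp add: graded_def)

lemma supported_mode_weight:
  assumes "supported (weight_space l) v"
  shows "supported (weight_space l) (mode G n y v)"
  unfolding mode_def
  by (rule supported_lin[OF assms])
     (auto simp: weight_space_def supported_ket intro!: supported_sum supported_smul)

text \<open>Creation adds one particle of energy \<open>- n\<close>, annihilation removes one of
  energy \<open>n\<close>, and the zero mode is diagonal.\<close>

lemma supported_mode_graded:
  assumes "supported (graded l e s) v"
  shows "supported (graded l (e - n) (s - sgn n)) (mode G n y v)"
  unfolding mode_def
proof (rule supported_lin[OF assms], goal_cases)
  case (1 l' M)
  then have l: "l' = l" and e: "e = int (energy M)" and s: "s = int (size M)"
    by (simp_all add: graded_def)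
  consider "n < 0" | "n = 0" | "n > 0" by linarith
  then show ?case
  proof cases
    case 1
    then show ?thesis
      by (auto simp: supported_ket graded_def l e s intro!: supported_sum supported_smul)
  next
    case 2
    then show ?thesis
      by (auto simp: supported_ket graded_def l e s intro!: supported_sum supported_smul)
  next
    case 3
    have "supported (graded l (e - n) (s - sgn n))
      (smul (of_int n * of_nat (count M (g, nat n)) * a) (ket l' (M - {#(g, nat n)#})))" for g a
    proof (cases "(g, nat n) \<in># M")
      case True
      then obtain M' where M: "M = add_mset (g, nat n) M'"
        by (metis mset_add)
      show ?thesis
        using 3 by (auto simp: supported_ket graded_def l e s M intro!: supported_smul)
    next
      \<comment> \<open>The multiset difference leaves \<open>M\<close> unchanged here, in the wrong
        degree, but the factor \<open>count\<close> is 0.\<close>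
      case False
      then show ?thesis by (simp add: not_in_iff)
    qed
    then show ?thesis using 3 by (auto intro!: supported_sum)
  qed
qed

lemma supported_pow_coeff_weight:
  assumes "supported (weight_space l) v"
  shows "supported (weight_space l) (pow_coeff (\<lambda>m. mode G (h m) (y m)) i m v)"
  using assms
  by (induction i arbitrary: m) (auto intro!: supported_sum supported_mode_weight)

lemma supported_exp_coeff_weight:
  assumes "supported (weight_space l) v"
  shows "supported (weight_space l) (exp_coeff (\<lambda>m. mode G (h m) (y m)) m v)"
  unfolding exp_coeff_def
  by (intro supported_sum supported_smul supported_pow_coeff_weight assms)

text \<open>The sign \<epsilon> treats annihilation and creation together. All \<open>i\<close>
  factors have modes of the same sign, so particle number moves by exactly \<open>i\<close>, while
  the mode indices add up to \<open>m\<close>.\<close>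

lemma supported_pow_coeff_graded:
  assumes "supported (graded l e s) v" "\<epsilon> = 1 \<or> \<epsilon> = - 1"
  shows "supported (graded l (e - \<epsilon> * int m) (s - \<epsilon> * int i))
           (pow_coeff (\<lambda>m. mode G (\<epsilon> * int m) (y m)) i m v)"
proof (induction i arbitrary: m)
  case 0
  then show ?case using assms by simp
next
  case (Suc i)
  show ?case
    unfolding pow_coeff.simps
  proof (rule supported_sum)
    fix n assume n: "n \<in> {1..m}"
    have "supported (graded l (e - \<epsilon> * int (m - n) - \<epsilon> * int n) (s - \<epsilon> * int i - sgn (\<epsilon> * int n)))
      (mode G (\<epsilon> * int n) (y n) (pow_coeff (\<lambda>m. mode G (\<epsilon> * int m) (y m)) i (m - n) v))"
      by (intro supported_mode_graded Suc.IH)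
    moreover have "e - \<epsilon> * int (m - n) - \<epsilon> * int n = e - \<epsilon> * int m"
      using n by (simp add: algebra_simps)
    moreover have "s - \<epsilon> * int i - sgn (\<epsilon> * int n) = s - \<epsilon> * int (Suc i)"
      using n assms(2) by (auto simp: sgn_mult algebra_simps)
    ultimately show "supported (graded l (e - \<epsilon> * int m) (s - \<epsilon> * int (Suc i)))
      (mode G (\<epsilon> * int n) (y n) (pow_coeff (\<lambda>m. mode G (\<epsilon> * int m) (y m)) i (m - n) v))"
      by simp
  qed
qed

text \<open>Each term would have the negative energy \<open>e - m\<close>.\<close>

lemma annihilation_eq_0:
  assumes "supported (graded l e s) v" "e < int m"
  shows "exp_coeff (\<lambda>m. mode G (int m) (y m)) m v = 0"
proof -
  have "pow_coeff (\<lambda>m. mode G (int m) (y m)) i m v = 0" for i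
    using supported_pow_coeff_graded[OF assms(1), of 1 m i G y] assms(2)
    by (simp add: graded_negative supported_empty)
  then show ?thesis by (simp add: exp_coeff_def)
qed

text \<open>The annihilation factor of index \<open>i\<close> kills the ket as soon as
  \<open>i\<close> exceeds its energy.\<close>

lemma finite_osc_support:
  "finite {i::nat. (if n + int i \<ge> 0
     then exp_coeff (\<lambda>m. mode G (- int m) (y (- int m))) (nat (n + int i))
            (exp_coeff (\<lambda>m. mode G (int m) (y (int m))) i (ket l M))
     else 0) \<noteq> 0}" (is "finite ?S")
proof (rule finite_subset)
  have zero: "exp_coeff (\<lambda>m. mode G (- int m) (y (- int m))) j 0 = 0" for j
    by (rule module_hom.zero[OF fock_linear_exp_coeff]) (rule fock_linear_mode)
  show "?S \<subseteq> {..energy M}"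
  proof
    fix i assume "i \<in> ?S"
    then have "exp_coeff (\<lambda>m. mode G (int m) (y (int m))) i (ket l M) \<noteq> 0"
      using zero by (auto split: if_splits)
    then show "i \<in> {..energy M}"
      using annihilation_eq_0[of l "int (energy M)" "int (size M)" "ket l M" i G "\<lambda>m. y (int m)"]
      by (cases "energy M < i") (simp_all add: supported_ket ket_in_graded)
  qed
qed simp

lemma fock_linear_osc: "fock_linear (osc G y n)"
proof -
  have "fock_linear (\<lambda>v. Sum_any (\<lambda>i::nat. if n + int i \<ge> 0
     then exp_coeff (\<lambda>m. mode G (- int m) (y (- int m))) (nat (n + int i))
            (exp_coeff (\<lambda>m. mode G (int m) (y (int m))) i v)
     else 0))"
  proof (rule fock_linear_Sum_any)
    fix i
    show "fock_linear (\<lambda>v. if n + int i \<ge> 0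
       then exp_coeff (\<lambda>m. mode G (- int m) (y (- int m))) (nat (n + int i))
              (exp_coeff (\<lambda>m. mode G (int m) (y (int m))) i v)
       else 0)"
      by (cases "n + int i \<ge> 0")
         (simp_all add: fock_linear_zero fock_linear_compose fock_linear_exp_coeff fock_linear_mode)
  qed (rule finite_osc_support)
  then show ?thesis by (simp flip: osc_def)
qed

lemma supported_osc_weight:
  assumes "supported (weight_space l) v"
  shows "supported (weight_space l) (osc G y n v)"
  unfolding osc_def
proof (rule supported_Sum_any)
  fix i
  show "supported (weight_space l) (if n + int i \<ge> 0
     then exp_coeff (\<lambda>m. mode G (- int m) (y (- int m))) (nat (n + int i))
            (exp_coeff (\<lambda>m. mode G (int m) (y (int m))) i v)
     else 0)"
    by (simp add: supported_exp_coeff_weight assms)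
qed

section \<open>Taking the constant term in \<open>\<hbar>\<close>\<close>

text \<open>Read: \<open>a\<close> has no pole at \<hbar> = 0 and its value there is
  \<open>b\<close>. As a relation, it carries regularity and value through all constructions at
  once.\<close>

definition fls_lim :: "complex fls \<Rightarrow> complex fls \<Rightarrow> bool" where
  "fls_lim a b \<longleftrightarrow> (\<exists>f. a = fps_to_fls f \<and> b = fls_const (fps_nth f 0))"

definition fock_lim :: "'g fock \<Rightarrow> 'g fock \<Rightarrow> bool" where
  "fock_lim v w \<longleftrightarrow> (\<forall>b. fls_lim (Poly_Mapping.lookup v b) (Poly_Mapping.lookup w b))"

lemma fls_lim_iff: "fls_lim a b \<longleftrightarrow> (\<forall>s<0. fls_nth a s = 0) \<and> b = fls_const (fls_nth a 0)"
proof
  assume *: "(\<forall>s<0. fls_nth a s = 0) \<and> b = fls_const (fls_nth a 0)"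
  then have "a = fps_to_fls (fls_regpart a)"
    by (intro fls_eqI) simp
  with * show "fls_lim a b"
    unfolding fls_lim_def by (intro exI[of _ "fls_regpart a"]) simp
qed (auto simp: fls_lim_def)

lemma fls_lim_const: "fls_lim (fls_const a) (fls_const a)"
  by (simp add: fls_lim_iff)

lemma fls_lim_0: "fls_lim 0 0"
  using fls_lim_const[of 0] by simp

lemma fls_lim_of_nat: "fls_lim (of_nat n) (of_nat n)"
  by (simp add: fls_of_nat fls_lim_const)

lemma fls_lim_of_int: "fls_lim (of_int n) (of_int n)"
  by (simp add: fls_of_int fls_lim_const)

lemma fls_lim_add: "fls_lim a b \<Longrightarrow> fls_lim a' b' \<Longrightarrow> fls_lim (a + a') (b + b')"
  by (auto simp: fls_lim_iff fls_plus_const)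

lemma fls_lim_mult:
  assumes "fls_lim a b" "fls_lim a' b'"
  shows "fls_lim (a * a') (b * b')"
proof -
  obtain f f' where "a = fps_to_fls f" "b = fls_const (fps_nth f 0)"
      "a' = fps_to_fls f'" "b' = fls_const (fps_nth f' 0)"
    using assms unfolding fls_lim_def by blast
  then show ?thesis
    unfolding fls_lim_def by (intro exI[of _ "f * f'"]) (simp add: fls_times_fps_to_fls)
qed

text \<open>Numerator and denominator vanish at \<hbar> = 0, the denominator to exactly first order.
  After one factor \<hbar> is cancelled the denominator is a unit, and the value is the ratio of the
  linear coefficients.\<close>

lemma fls_lim_divide:
  assumes "fps_nth f 0 = 0" "fps_nth f 1 = a" "fps_nth D 0 = 0" "fps_nth D 1 = \<delta>" "\<delta> \<noteq> 0"
  shows "fls_lim (fps_to_fls f / fps_to_fls D) (fls_const (a / \<delta>))"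
proof -
  have X: "f = fps_X * fps_shift 1 f" "D = fps_X * fps_shift 1 D"
    using assms by (simp_all add: fps_eq_iff)
  have D: "fps_nth (fps_shift 1 D) 0 \<noteq> 0" using assms by simp
  have "fps_to_fls f / fps_to_fls D = fps_to_fls (fps_shift 1 f) / fps_to_fls (fps_shift 1 D)"
    by (subst X(1), subst X(2)) (simp add: fls_times_fps_to_fls)
  also have "\<dots> = fps_to_fls (fps_shift 1 f * inverse (fps_shift 1 D))"
    using D by (simp add: divide_inverse fls_times_fps_to_fls fls_inverse_fps_to_fls)
  finally show ?thesis
    unfolding fls_lim_def using assms
    by (intro exI[of _ "fps_shift 1 f * inverse (fps_shift 1 D)"])
       (simp add: divide_inverse)
qed

lemma fock_lim_0: "fock_lim 0 0"
  by (simp add: fock_lim_def fls_lim_0)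

lemma fock_lim_0D: "fock_lim 0 w \<Longrightarrow> w = 0"
  by (auto intro!: poly_mapping_eqI simp: fock_lim_def fls_lim_iff)

lemma fock_lim_ket: "fock_lim (ket l M) (ket l M)"
  using fls_lim_const[of 0] fls_lim_const[of 1] by (simp add: fock_lim_def lookup_ket)

lemma fock_lim_add: "fock_lim v w \<Longrightarrow> fock_lim v' w' \<Longrightarrow> fock_lim (v + v') (w + w')"
  by (simp add: fock_lim_def lookup_add fls_lim_add)

lemma fock_lim_smul: "fls_lim a b \<Longrightarrow> fock_lim v w \<Longrightarrow> fock_lim (smul a v) (smul b w)"
  by (simp add: fock_lim_def fls_lim_mult)

lemma fock_lim_sum: "(\<And>i. i \<in> I \<Longrightarrow> fock_lim (f i) (g i)) \<Longrightarrow> fock_lim (sum f I) (sum g I)"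
  by (induction I rule: infinite_finite_induct) (auto simp: fock_lim_0 fock_lim_add)

lemma fock_lim_lin:
  assumes "fock_lim v w" "\<And>l M. fock_lim (f l M) (g l M)"
  shows "fock_lim (lin f v) (lin g w)"
proof -
  let ?S = "Poly_Mapping.keys v \<union> Poly_Mapping.keys w"
  have "fock_lim (\<Sum>b\<in>?S. smul (Poly_Mapping.lookup v b) (f (fst b) (snd b)))
                 (\<Sum>b\<in>?S. smul (Poly_Mapping.lookup w b) (g (fst b) (snd b)))"
    using assms by (intro fock_lim_sum fock_lim_smul) (auto simp: fock_lim_def)
  then show ?thesis by (simp add: lin_superset[of ?S])
qed

lemma fock_lim_Sum_any:
  assumes "\<And>i. fock_lim (f i) (g i)" "finite {i. f i \<noteq> 0}"
  shows "fock_lim (Sum_any f) (Sum_any g)"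
proof -
  \<comment> \<open>The limit of 0 is 0, so the support of \<open>f\<close> bounds both
    sums.\<close>
  have "{i. g i \<noteq> 0} \<subseteq> {i. f i \<noteq> 0}"
    using assms(1) fock_lim_0D by (metis (mono_tags, lifting) Collect_mono)
  then have "Sum_any g = sum g {i. f i \<noteq> 0}"
    using assms(2) by (intro Sum_any.expand_superset) auto
  then show ?thesis
    using assms(1) by (simp add: Sum_any.expand_set fock_lim_sum)
qed

text \<open>Annihilation modes see a vector only through its contraction with the possibly degenerate
  form \<open>G\<close>, so regularity is required of the contraction only.\<close>

definition modes_lim ::
  "('g::finite \<Rightarrow> 'g \<Rightarrow> complex) \<Rightarrow> (int \<Rightarrow> 'g \<Rightarrow> complex fls) \<Rightarrow> (int \<Rightarrow> 'g \<Rightarrow> complex fls) \<Rightarrow> bool" where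
  "modes_lim G y y' \<longleftrightarrow>
     (\<forall>n<0. \<forall>g. fls_lim (y n g) (y' n g)) \<and>
     (\<forall>n>0. \<forall>g. fls_lim (\<Sum>h\<in>UNIV. y n h * fls_const (G h g)) (\<Sum>h\<in>UNIV. y' n h * fls_const (G h g)))"

lemma fock_lim_mode:
  assumes "modes_lim G y y'" "n \<noteq> 0" "fock_lim v w"
  shows "fock_lim (mode G n (y n) v) (mode G n (y' n) w)"
  unfolding mode_def
  by (rule fock_lim_lin)
     (use assms in \<open>auto simp: modes_lim_def intro!: fock_lim_sum fock_lim_smul fock_lim_ket
        fls_lim_mult fls_lim_of_int fls_lim_of_nat\<close>)

lemma fock_lim_exp_coeff:
  assumes "\<And>n v w. n > 0 \<Longrightarrow> fock_lim v w \<Longrightarrow> fock_lim (a n v) (a' n w)" "fock_lim v w"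
  shows "fock_lim (exp_coeff a m v) (exp_coeff a' m w)"
proof -
  have "fock_lim (pow_coeff a i m v) (pow_coeff a' i m w)" for i
    by (induction i arbitrary: m) (auto simp: fock_lim_0 assms intro!: fock_lim_sum)
  then show ?thesis
    unfolding exp_coeff_def by (intro fock_lim_sum fock_lim_smul fls_lim_const)
qed

lemma fock_lim_osc:
  assumes "modes_lim G y y'"
  shows "fock_lim (osc G y n (ket l M)) (osc G y' n (ket l M))"
  unfolding osc_def
proof (rule fock_lim_Sum_any)
  fix i
  show "fock_lim
    (if n + int i \<ge> 0
     then exp_coeff (\<lambda>m. mode G (- int m) (y (- int m))) (nat (n + int i))
            (exp_coeff (\<lambda>m. mode G (int m) (y (int m))) i (ket l M)) else 0)
    (if n + int i \<ge> 0
     then exp_coeff (\<lambda>m. mode G (- int m) (y' (- int m))) (nat (n + int i))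
            (exp_coeff (\<lambda>m. mode G (int m) (y' (int m))) i (ket l M)) else 0)"
    by (auto simp: fock_lim_0 fock_lim_ket intro!: fock_lim_exp_coeff fock_lim_mode[OF assms])
qed (rule finite_osc_support)

section \<open>Vertex operators\<close>

text \<open>Each weight space sees a single power of z, possibly with logarithms. This makes the sum
  over \<open>n\<close> in \<open>vertex\<close> finite.\<close>

definition weight_exponents :: "('g vec \<Rightarrow> complex) \<Rightarrow> 'g field \<Rightarrow> bool" where
  "weight_exponents e Z \<longleftrightarrow>
     (\<forall>l r j v. supported (weight_space l) v \<longrightarrow> r \<noteq> e l \<longrightarrow> Z (r, j) v = 0)"

text \<open>Oscillators preserve the weight \<open>l\<close>, so a nonzero term forces
  \<open>r - n = e l\<close>, which leaves at most one \<open>n\<close>.\<close>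

lemma finite_vertex_support:
  assumes "weight_exponents e Z"
  shows "finite {n::int. Z (r - of_int n, j) (osc G y n (ket l M)) \<noteq> 0}"
proof (rule finite_subset)
  have "Z (r - of_int n, j) (osc G y n (ket l M)) = 0" if "r - of_int n \<noteq> e l" for n
  proof -
    have "supported (weight_space l) (osc G y n (ket l M))"
      by (rule supported_osc_weight) (simp add: supported_ket weight_space_def)
    then show ?thesis
      using assms that unfolding weight_exponents_def by blast
  qed
  \<comment> \<open>The floor of the real part only names the integer that \<open>r - e l\<close>
    must be.\<close>
  then show "{n::int. Z (r - of_int n, j) (osc G y n (ket l M)) \<noteq> 0} \<subseteq> {\<lfloor>Re (r - e l)\<rfloor>}"
    by (smt (verit) add_diff_cancel_left' diff_add_cancel floor_of_int mem_Collect_eq of_real_of_int_eq Re_complex_of_real singleton_iff subsetI)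
qed simp

lemma fock_linear_vertex:
  assumes "weight_exponents e Z" "\<And>rj. fock_linear (Z rj)"
  shows "fock_linear (vertex G Z y rj)"
proof (cases rj)
  case (Pair r j)
  have "fock_linear (\<lambda>v. Sum_any (\<lambda>n::int. Z (r - of_int n, j) (osc G y n v)))"
    by (rule fock_linear_Sum_any[OF fock_linear_compose[OF assms(2) fock_linear_osc]
          finite_vertex_support[OF assms(1)]])
  then show ?thesis by (simp add: Pair vertex_def)
qed

lemma fock_lim_vertex:
  assumes "modes_lim G y y'" "weight_exponents e Z"
    and "\<And>r j v w. fock_lim v w \<Longrightarrow> fock_lim (Z (r, j) v) (Z' (r, j) w)"
  shows "fock_lim (vertex G Z y rj (ket l M)) (vertex G Z' y' rj (ket l M))"
proof (cases rj)
  case (Pair r j)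
  show ?thesis
    unfolding Pair vertex_def prod.case
    by (intro fock_lim_Sum_any assms(3) fock_lim_osc[OF assms(1)] finite_vertex_support[OF assms(2)])
qed

section \<open>Leading terms of fields in \<hbar>\<close>

lemma lookup_hbar_term_ket:
  "Poly_Mapping.lookup (hbar_term s F rj (ket l M)) b =
     fls_const (fls_nth (Poly_Mapping.lookup (F rj (ket l M)) b) s)"
  by (simp add: hbar_term_def Poly_Mapping.map.rep_eq when_def)

lemma eq_mod_hbarD:
  assumes "eq_mod_hbar m F H" "s < m"
  shows "fls_nth (Poly_Mapping.lookup (F rj (ket l M)) b) s =
         fls_nth (Poly_Mapping.lookup (H rj (ket l M)) b) s"
proof -
  have "hbar_term s F rj (ket l M) = hbar_term s H rj (ket l M)"
    using assms by (simp add: eq_mod_hbar_def)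
  then have "Poly_Mapping.lookup (hbar_term s F rj (ket l M)) b =
      Poly_Mapping.lookup (hbar_term s H rj (ket l M)) b" by simp
  then show ?thesis
    unfolding lookup_hbar_term_ket by (metis fls_const_nth)
qed

text \<open>\<open>hbar_term\<close> is extended linearly from kets by definition, so limits on kets
  suffice; linearity of \<open>H\<close> then carries the equality to all vectors.\<close>

lemma hbar_leading_term:
  assumes "\<And>rj l M. fock_lim (F rj (ket l M)) (H rj (ket l M))" "\<And>rj. fock_linear (H rj)"
  shows "hbar_expandable F \<and> hbar_term 0 F = H"
proof
  have lin: "fock_linear (hbar_term s F rj)" for s rj
    unfolding hbar_term_def by (rule linear_lin)
  note lim = assms(1)[unfolded fock_lim_def fls_lim_iff, rule_format]
  show "hbar_term 0 F = H"
  proof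
    fix rj
    show "hbar_term 0 F rj = H rj"
    proof (rule fock_linear_eqI[OF lin assms(2)], rule poly_mapping_eqI)
      fix l M b
      show "Poly_Mapping.lookup (hbar_term 0 F rj (ket l M)) b = Poly_Mapping.lookup (H rj (ket l M)) b"
        unfolding lookup_hbar_term_ket using lim[of rj l M b] by metis
    qed
  qed
  show "hbar_expandable F"
    unfolding hbar_expandable_def
  proof (intro allI impI ext)
    fix s :: int and rj v assume "s < 0"
    have "hbar_term s F rj = (\<lambda>v. 0)"
      by (rule fock_linear_eqI[OF lin fock_linear_zero])
         (rule poly_mapping_eqI, simp only: lookup_hbar_term_ket lim \<open>s < 0\<close>, simp)
    then show "hbar_term s F rj v = 0 rj v" by simp
  qed
qed

section \<open>Zero-mode factors and their values at \<hbar> = 0\<close>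

lemma diag_weight: "supported (weight_space l) v \<Longrightarrow> diag e v = smul (fps_to_fls (e l)) v"
proof -
  assume *: "supported (weight_space l) v"
  have "diag e v = lin (\<lambda>l' M. smul (fps_to_fls (e l)) (ket l' M)) v"
    unfolding diag_def lin_def
    by (rule sum.cong) (use * in \<open>auto simp: supported_def weight_space_def\<close>)
  also have "\<dots> = smul (fps_to_fls (e l)) (lin ket v)"
    by (simp add: lin_def fock.scale_sum_right mult.commute)
  finally show ?thesis by (simp flip: ket_expansion)
qed

lemma weight_exponents_zpow: "weight_exponents (\<lambda>l. fps_nth (e l) 0) (zpow e)"
  unfolding weight_exponents_def zpow_def by (auto simp: diag_weight)

lemma weight_exponents_compose:
  assumes "weight_exponents e Z" "fock_linear A"
  shows "weight_exponents e (\<lambda>rj v. A (Z rj v))"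
  using assms module_hom.zero[OF assms(2)] by (simp add: weight_exponents_def)

text \<open>At the exponent \<open>r\<close> that occurs, \<open>e l - r\<close> has no constant
  term, so its positive powers vanish at \<hbar> = 0. The logarithms disappear and only j = 0, with
  coefficient 1, survives.\<close>

lemma fock_lim_zpow:
  assumes "\<And>l. e' l = fps_const (fps_nth (e l) 0)" "fock_lim v w"
  shows "fock_lim (zpow e (r, j) v) (zpow e' (r, j) w)"
  unfolding zpow_def diag_def prod.case
proof (rule fock_lim_lin[OF assms(2)])
  fix l :: "'a vec" and M
  have "fls_lim
    (fps_to_fls (if r = fps_nth (e l) 0 then fps_const (1 / fact j) * (e l - fps_const r) ^ j else 0))
    (fps_to_fls (if r = fps_nth (e' l) 0 then fps_const (1 / fact j) * (e' l - fps_const r) ^ j else 0))"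
    by (auto simp: assms(1) fls_lim_iff fps_nth_power_0 power_0_left)
  then show "fock_lim
    (smul (fps_to_fls (if r = fps_nth (e l) 0 then fps_const (1 / fact j) * (e l - fps_const r) ^ j else 0)) (ket l M))
    (smul (fps_to_fls (if r = fps_nth (e' l) 0 then fps_const (1 / fact j) * (e' l - fps_const r) ^ j else 0)) (ket l M))"
    by (rule fock_lim_smul) (rule fock_lim_ket)
qed

lemma fock_lim_shift: "fock_lim v w \<Longrightarrow> fock_lim (shift x v) (shift x w)"
  unfolding shift_def by (rule fock_lim_lin) (simp_all add: fock_lim_ket)

lemma fock_linear_exp_field: "fock_linear (exp_field G x rj)"
  unfolding exp_field_def left_ordered_def
  by (rule fock_linear_vertex[OF weight_exponents_compose[OF weight_exponents_zpow fock_linear_shift]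
        fock_linear_compose[OF fock_linear_shift fock_linear_zpow]])

text \<open>The operator \<open>A\<close> may depend on \<hbar> as long as it tends to
  \<open>shift x\<close>. This covers both kinds of current: \<open>A\<close> is the shift itself
  for \<open>Psi_star\<close> and the given zero-mode operator for \<open>S_minus\<close>.\<close>

lemma vertex_leading_term:
  assumes "modes_lim G y (\<lambda>n. cvec ((- 1 / of_int n) *\<^sub>v x))"
    and "\<And>l. fps_nth (e l) 0 = bil G x l"
    and "fock_linear A" "\<And>v w. fock_lim v w \<Longrightarrow> fock_lim (A v) (shift x w)"
  shows "hbar_expandable (vertex G (\<lambda>rj v. A (zpow e rj v)) y) \<and>
         hbar_term 0 (vertex G (\<lambda>rj v. A (zpow e rj v)) y) = exp_field G x"
  unfolding exp_field_def
proof (rule hbar_leading_term)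
  show "fock_linear (vertex G (left_ordered x (zpow (zero_mode G x))) (\<lambda>n. cvec ((- 1 / of_int n) *\<^sub>v x)) rj)" for rj
    using fock_linear_exp_field[of G x rj] by (simp add: exp_field_def)
  show "fock_lim (vertex G (\<lambda>rj v. A (zpow e rj v)) y rj (ket l M))
    (vertex G (left_ordered x (zpow (zero_mode G x))) (\<lambda>n. cvec ((- 1 / of_int n) *\<^sub>v x)) rj (ket l M))" for rj l M
    unfolding left_ordered_def
    by (rule fock_lim_vertex[OF assms(1) weight_exponents_compose[OF weight_exponents_zpow assms(3)]])
       (auto intro!: assms(4) fock_lim_zpow simp: zero_mode_def assms(2))
qed

section \<open>Modes from the order \<open>\<hbar>\<close> of a vertex operator\<close>

lemma exp_coeff_0 [simp]: "exp_coeff a 0 v = v"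
  by (simp add: exp_coeff_def)

text \<open>The power 0 contributes only to m = 0, and the powers from 2 on miss the component
  \<open>b\<close> by assumption, so only the linear term remains.\<close>

lemma exp_coeff_linear_part:
  assumes "m > 0" "\<And>i. i \<ge> 2 \<Longrightarrow> Poly_Mapping.lookup (pow_coeff a i m v) b = 0"
    and "\<And>n. fock_linear (a n)"
  shows "Poly_Mapping.lookup (exp_coeff a m v) b = Poly_Mapping.lookup (a m v) b"
proof -
  \<comment> \<open>The inner power 0 is nonzero only at \<open>m - n = 0\<close>.\<close>
  have "pow_coeff a (Suc 0) m v = (\<Sum>n=1..m. if n = m then a m v else 0)"
    unfolding pow_coeff.simps
    by (intro sum.cong) (auto simp: module_hom.zero[OF assms(3)])
  then have 1: "pow_coeff a (Suc 0) m v = a m v" using assms(1) by simp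
  have "Poly_Mapping.lookup (exp_coeff a m v) b =
      (\<Sum>i\<le>m. fls_const (1 / fact i) * Poly_Mapping.lookup (pow_coeff a i m v) b)"
    by (simp add: exp_coeff_def lookup_sum)
  also have "\<dots> = (\<Sum>i\<in>{1}. fls_const (1 / fact i) * Poly_Mapping.lookup (pow_coeff a i m v) b)"
  proof (rule sum.mono_neutral_right)
    show "\<forall>i\<in>{..m} - {1}. fls_const (1 / fact i) * Poly_Mapping.lookup (pow_coeff a i m v) b = 0"
    proof
      fix i assume "i \<in> {..m} - {1}"
      then consider "i = 0" | "i \<ge> 2" by force
      then show "fls_const (1 / fact i) * Poly_Mapping.lookup (pow_coeff a i m v) b = 0"
        using assms(1,2) by cases auto
    qed
  qed (use assms(1) in auto)
  finally show ?thesis by (simp add: 1 del: pow_coeff.simps)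
qed

lemma lookup_mode_creation:
  assumes "n > 0"
  shows "Poly_Mapping.lookup (mode G (- int n) y (ket l {#})) (l, {#(g, n)#}) = y g"
  using assms by (simp add: mode_def lookup_sum lookup_ket if_distrib cong: if_cong)

lemma lookup_mode_annihilation:
  assumes "n > 0"
  shows "Poly_Mapping.lookup (mode G (int n) y (ket l {#(g, n)#})) (l, {#}) =
           of_nat n * (\<Sum>h\<in>UNIV. y h * fls_const (G h g))"
proof -
  let ?s = "\<lambda>g. \<Sum>h\<in>UNIV. y h * fls_const (G h g)"
  have "Poly_Mapping.lookup (mode G (int n) y (ket l {#(g, n)#})) (l, {#}) =
      (\<Sum>g'\<in>UNIV. of_nat n * of_nat (count {#(g, n)#} (g', n)) * ?s g' *
         Poly_Mapping.lookup (ket l ({#(g, n)#} - {#(g', n)#})) (l, {#}))"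
    using assms by (simp add: mode_def lookup_sum)
  also have "\<dots> = (\<Sum>g'\<in>UNIV. if g' = g then of_nat n * ?s g else 0)"
    by (intro sum.cong) (auto simp: lookup_ket)
  finally show ?thesis by simp
qed

text \<open>On the vacuum the annihilation factor contributes only its constant term. The i-th power
  of the creation part makes \<open>i\<close> particles, so a one-particle component comes from i =
  1.\<close>

lemma lookup_osc_creation:
  assumes "n > 0"
  shows "Poly_Mapping.lookup (osc G y (int n) (ket l {#})) (l, {#(g, n)#}) = y (- int n) g"
proof -
  let ?c = "\<lambda>m. mode G (- int m) (y (- int m))"
  let ?a = "\<lambda>m. mode G (int m) (y (int m))"
  have vac: "supported (graded l 0 0) (ket l {#})"
    by (simp add: supported_ket graded_def)
  have zero: "exp_coeff ?c j 0 = 0" for j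
    by (rule module_hom.zero[OF fock_linear_exp_coeff]) (rule fock_linear_mode)
  have ann: "exp_coeff ?a i (ket l {#}) = 0" if "i > 0" for i
    using annihilation_eq_0[OF vac, of i G "\<lambda>m. y (int m)"] that by simp
  have "osc G y (int n) (ket l {#}) = (\<Sum>i\<in>{0}. if int n + int i \<ge> 0
     then exp_coeff ?c (nat (int n + int i)) (exp_coeff ?a i (ket l {#})) else 0)"
    unfolding osc_def
  proof (rule Sum_any.expand_superset)
    show "{i. (if 0 \<le> int n + int i then exp_coeff ?c (nat (int n + int i)) (exp_coeff ?a i (ket l {#})) else 0) \<noteq> 0} \<subseteq> {0}"
      using ann zero by (auto intro: ccontr)
  qed simp
  then have "osc G y (int n) (ket l {#}) = exp_coeff ?c n (ket l {#})" by simp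
  moreover have "Poly_Mapping.lookup (exp_coeff ?c n (ket l {#})) (l, {#(g, n)#}) =
      Poly_Mapping.lookup (?c n (ket l {#})) (l, {#(g, n)#})"
  proof (rule exp_coeff_linear_part[OF assms _ fock_linear_mode])
    fix i :: nat assume "i \<ge> 2"
    have "supported (graded l (int n) (int i)) (pow_coeff ?c i n (ket l {#}))"
      using supported_pow_coeff_graded[OF vac, of "- 1" n i G "\<lambda>m. y (- int m)"] by simp
    then show "Poly_Mapping.lookup (pow_coeff ?c i n (ket l {#})) (l, {#(g, n)#}) = 0"
      by (rule lookup_not_supported) (use \<open>i \<ge> 2\<close> in \<open>auto simp: graded_def\<close>)
  qed
  ultimately show ?thesis by (simp add: lookup_mode_creation assms)
qed

text \<open>The creation index \<open>i - n\<close> must be nonnegative and the available energy is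
  \<open>n\<close>, so i = n. Powers from 2 on would remove more than the one particle
  present.\<close>

lemma lookup_osc_annihilation:
  assumes "n > 0"
  shows "Poly_Mapping.lookup (osc G y (- int n) (ket l {#(g, n)#})) (l, {#}) =
           of_nat n * (\<Sum>h\<in>UNIV. y (int n) h * fls_const (G h g))"
proof -
  let ?c = "\<lambda>m. mode G (- int m) (y (- int m))"
  let ?a = "\<lambda>m. mode G (int m) (y (int m))"
  let ?v = "ket l {#(g, n)#}"
  have v: "supported (graded l (int n) 1) ?v"
    by (simp add: supported_ket graded_def)
  have zero: "exp_coeff ?c j 0 = 0" for j
    by (rule module_hom.zero[OF fock_linear_exp_coeff]) (rule fock_linear_mode)
  have ann: "exp_coeff ?a i ?v = 0" if "i > n" for i
    using annihilation_eq_0[OF v, of i G "\<lambda>m. y (int m)"] that by simp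
  have "osc G y (- int n) ?v = (\<Sum>i\<in>{n}. if - int n + int i \<ge> 0
     then exp_coeff ?c (nat (- int n + int i)) (exp_coeff ?a i ?v) else 0)"
    unfolding osc_def
  proof (rule Sum_any.expand_superset)
    show "{i. (if 0 \<le> - int n + int i then exp_coeff ?c (nat (- int n + int i)) (exp_coeff ?a i ?v) else 0) \<noteq> 0} \<subseteq> {n}"
    proof
      fix i assume *: "i \<in> {i. (if 0 \<le> - int n + int i then exp_coeff ?c (nat (- int n + int i)) (exp_coeff ?a i ?v) else 0) \<noteq> 0}"
      then have "i \<ge> n" by (auto split: if_splits)
      moreover have "\<not> i > n" using * ann zero by auto
      ultimately show "i \<in> {n}" by simp
    qed
  qed simp
  then have "osc G y (- int n) ?v = exp_coeff ?a n ?v" by simp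
  moreover have "Poly_Mapping.lookup (exp_coeff ?a n ?v) (l, {#}) =
      Poly_Mapping.lookup (?a n ?v) (l, {#})"
  proof (rule exp_coeff_linear_part[OF assms _ fock_linear_mode])
    fix i :: nat assume "i \<ge> 2"
    have "supported (graded l 0 (1 - int i)) (pow_coeff ?a i n ?v)"
      using supported_pow_coeff_graded[OF v, of 1 n i G "\<lambda>m. y (int m)"] by simp
    then show "Poly_Mapping.lookup (pow_coeff ?a i n ?v) (l, {#}) = 0"
      using \<open>i \<ge> 2\<close> by (simp add: graded_negative supported_empty)
  qed
  ultimately show ?thesis by (simp add: lookup_mode_annihilation assms)
qed

section \<open>Comparison with the given expansions\<close>

lemma fps_to_fls_sum: "fps_to_fls (sum f I) = (\<Sum>i\<in>I. fps_to_fls (f i))"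
  by (induction I rule: infinite_finite_induct) simp_all

lemma fvec_contraction:
  "(\<Sum>h\<in>UNIV. fvec y h * fls_const (G h g)) = fps_to_fls (\<Sum>h\<in>UNIV. y h * fps_const (G h g))"
  by (simp add: fps_to_fls_sum fls_times_fps_to_fls fvec_def)

lemma vertex_const_field:
  assumes "fock_linear A"
  shows "vertex G (const_field A) y (of_int n, 0) v = A (osc G y n v)"
proof -
  have "vertex G (const_field A) y (of_int n, 0) v =
      Sum_any (\<lambda>m::int. if m = n then A (osc G y n v) else 0)"
    unfolding vertex_def const_field_def prod.case by (rule Sum_any.cong) auto
  also have "\<dots> = (\<Sum>m\<in>{n}. if m = n then A (osc G y n v) else 0)"
    by (rule Sum_any.expand_superset) auto
  finally show ?thesis by simp
qed

text \<open>The coefficient \<open>z\<^sup>\<plusminus>\<^sup>n\<close> of \<open>X(z)\<close> between the vacuum and a one-particle state contains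
  the mode \<open>x\<^sub>\<mp>\<^sub>n\<close> only linearly, and weight \<open>0\<close> removes the zero modes.\<close>

lemma first_order_modes:
  fixes x :: "int \<Rightarrow> 'g::finite \<Rightarrow> complex fps"
  assumes X: "eq_mod_hbar 2 (vertex G (const_field A) (\<lambda>n. fvec (x n))) H"
    and A: "fock_linear A"
      "\<And>v M. Poly_Mapping.lookup (A v) (0, M) = fls_const \<epsilon> * Poly_Mapping.lookup v (0, M)"
    and \<epsilon>: "\<epsilon> \<noteq> 0"
    and H: "\<And>n M. n \<noteq> 0 \<Longrightarrow> H (of_int n, 0) (ket 0 M) =
       smul (fls_X * fls_const \<epsilon>) (mode G (- n) (cvec a) (ket 0 M))"
    and n: "n > (0::nat)"
  shows "fps_nth (x (- int n) g) 0 = 0 \<and> fps_nth (x (- int n) g) 1 = a g"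
    and "fps_nth (\<Sum>h\<in>UNIV. x (int n) h * fps_const (G h g)) 0 = 0 \<and>
         fps_nth (\<Sum>h\<in>UNIV. x (int n) h * fps_const (G h g)) 1 = (\<Sum>h\<in>UNIV. a h * G h g)"
proof -
  \<comment> \<open>\<open>H\<close> is \<hbar> \<epsilon> times a mode with constant matrix
    elements, so order 0 vanishes and order 1 is \<epsilon> times that element. Both orders lie
    below the cutoff 2, and \<open>A\<close> contributes the factor \<epsilon> on weight 0.\<close>
  have coeff: "\<epsilon> * fls_nth (Poly_Mapping.lookup (osc G (\<lambda>n. fvec (x n)) m (ket 0 M)) (0, M')) s =
      (if s = 1 then \<epsilon> * fls_nth f 0 else 0)"
    if "m \<noteq> 0" "s = 0 \<or> s = 1"
      "Poly_Mapping.lookup (mode G (- m) (cvec a) (ket 0 M)) (0, M') = fls_const (fls_nth f 0)" for m M M' s f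
  proof -
    have "fls_nth (Poly_Mapping.lookup (vertex G (const_field A) (\<lambda>n. fvec (x n)) (of_int m, 0) (ket 0 M)) (0, M')) s
        = fls_nth (Poly_Mapping.lookup (H (of_int m, 0) (ket 0 M)) (0, M')) s"
      using that by (intro eq_mod_hbarD[OF X]) auto
    then show ?thesis
      using that by (auto simp: vertex_const_field[OF A(1)] A(2) H mult.assoc fls_X_times_conv_shift)
  qed
  have "\<epsilon> * fls_nth (Poly_Mapping.lookup (osc G (\<lambda>n. fvec (x n)) (int n) (ket 0 {#})) (0, {#(g, n)#})) s =
      (if s = 1 then \<epsilon> * fls_nth (fls_const (a g)) 0 else 0)" if "s = 0 \<or> s = 1" for s
    using n that by (intro coeff) (simp_all add: lookup_mode_creation cvec_def)
  from this[of 0] this[of 1]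
  show "fps_nth (x (- int n) g) 0 = 0 \<and> fps_nth (x (- int n) g) 1 = a g"
    using \<epsilon> by (simp add: lookup_osc_creation[OF n] fvec_def)

  \<comment> \<open>Annihilation shows \<open>x (int n)\<close> only through its contraction with
    \<open>G\<close>. The factor \<open>n\<close> occurs on both sides of the comparison and cancels
    at the end.\<close>
  have "Poly_Mapping.lookup (mode G (int n) (cvec a) (ket 0 {#(g, n)#})) (0, {#}) =
      of_nat n * (\<Sum>h\<in>UNIV. fls_const (a h) * fls_const (G h g))"
    by (simp only: lookup_mode_annihilation[OF n] cvec_def)
  also have "\<dots> = fls_const (of_nat n * (\<Sum>h\<in>UNIV. a h * G h g))"
    by (rule fls_eqI) (simp add: fls_of_nat fls_nth_sum sum_distrib_left)
  finally have "\<epsilon> * fls_nth (Poly_Mapping.lookup (osc G (\<lambda>n. fvec (x n)) (- int n) (ket 0 {#(g, n)#})) (0, {#})) s =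
      (if s = 1 then \<epsilon> * fls_nth (fls_const (of_nat n * (\<Sum>h\<in>UNIV. a h * G h g))) 0 else 0)"
    if "s = 0 \<or> s = 1" for s
    using n that by (intro coeff) simp_all
  from this[of 0] this[of 1]
  show "fps_nth (\<Sum>h\<in>UNIV. x (int n) h * fps_const (G h g)) 0 = 0 \<and>
        fps_nth (\<Sum>h\<in>UNIV. x (int n) h * fps_const (G h g)) 1 = (\<Sum>h\<in>UNIV. a h * G h g)"
    using \<epsilon> n
    unfolding lookup_osc_annihilation[OF n] fvec_contraction fls_of_nat fls_mult_const_nth by simp
qed

text \<open>The quotient tends to \<open>a / (\<delta> n)\<close>. It is written with two minus
  signs to match the modes of \<open>exp_field\<close> for the vector
  \<open>- a / \<delta>\<close>.\<close>

lemma modes_lim_divide: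
  assumes "\<And>n g. n > (0::nat) \<Longrightarrow> fps_nth (x (- int n) g) 0 = 0 \<and> fps_nth (x (- int n) g) 1 = a g"
    and "\<And>n g. n > (0::nat) \<Longrightarrow> fps_nth (\<Sum>h\<in>UNIV. x (int n) h * fps_const (G h g)) 0 = 0 \<and>
         fps_nth (\<Sum>h\<in>UNIV. x (int n) h * fps_const (G h g)) 1 = (\<Sum>h\<in>UNIV. a h * G h g)"
    and "\<And>n. fps_nth (D n) 0 = 0" "\<And>n. fps_nth (D n) 1 = \<delta> * of_int n" "\<delta> \<noteq> 0"
  shows "modes_lim G (\<lambda>n g. fvec (x n) g / fps_to_fls (D n))
           (\<lambda>n. cvec ((- 1 / of_int n) *\<^sub>v ((- 1 / \<delta>) *\<^sub>v a)))"
  unfolding modes_lim_def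
proof (intro conjI allI impI)
  fix n :: int and g assume "n < 0"
  then have "fls_lim (fps_to_fls (x n g) / fps_to_fls (D n)) (fls_const (a g / (\<delta> * of_int n)))"
    using assms(1)[of "nat (- n)" g] assms(3-) by (intro fls_lim_divide) auto
  then show "fls_lim (fvec (x n) g / fps_to_fls (D n)) (cvec ((- 1 / of_int n) *\<^sub>v ((- 1 / \<delta>) *\<^sub>v a)) g)"
    by (simp add: fvec_def cvec_def vscale_def mult.commute)
next
  fix n :: int and g assume "n > 0"
  then have "fls_lim (fps_to_fls (\<Sum>h\<in>UNIV. x n h * fps_const (G h g)) / fps_to_fls (D n))
      (fls_const ((\<Sum>h\<in>UNIV. a h * G h g) / (\<delta> * of_int n)))"
    using assms(2)[of "nat n" g] assms(3-) by (intro fls_lim_divide) auto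
  moreover have "fls_const ((\<Sum>h\<in>UNIV. a h * G h g) / (\<delta> * of_int n)) =
      (\<Sum>h\<in>UNIV. cvec ((- 1 / of_int n) *\<^sub>v ((- 1 / \<delta>) *\<^sub>v a)) h * fls_const (G h g))"
    by (rule fls_eqI) (simp add: cvec_def vscale_def fls_nth_sum sum_divide_distrib mult.commute)
  ultimately show "fls_lim (\<Sum>h\<in>UNIV. fvec (x n) h / fps_to_fls (D n) * fls_const (G h g))
      (\<Sum>h\<in>UNIV. cvec ((- 1 / of_int n) *\<^sub>v ((- 1 / \<delta>) *\<^sub>v a)) h * fls_const (G h g))"
    by (simp add: sum_divide_distrib flip: fvec_contraction)
qed

section \<open>The screening currents\<close>

lemma bil_simps:
  "bil G (x + y) l = bil G x l + bil G y l" "bil G (a *\<^sub>v x) l = a * bil G x l"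
  "bil G x (l + m) = bil G x l + bil G x m" "bil G x (a *\<^sub>v l) = a * bil G x l"
  "bil G (- x) l = - bil G x l" "bil G x 0 = 0"
  by (simp_all add: bil_def vscale_def algebra_simps sum.distrib sum_distrib_left sum_negf)

lemma mode_cvec_add: "mode G n (cvec x) v + mode G n (cvec y) v = mode G n (cvec (x + y)) v"
proof (rule fock_linear_eq_at[of "\<lambda>v. mode G n (cvec x) v + mode G n (cvec y) v"])
  show "fock_linear (\<lambda>v. mode G n (cvec x) v + mode G n (cvec y) v)"
    using fock_linear_mode[of G n "cvec x"] fock_linear_mode[of G n "cvec y"]
    by (simp add: module_hom_iff fock.scale_right_distrib)
  show "mode G n (cvec x) (ket l M) + mode G n (cvec y) (ket l M) = mode G n (cvec (x + y)) (ket l M)" for l M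
    by (simp add: mode_def cvec_def sum.distrib algebra_simps flip: fls_plus_const)
qed (rule fock_linear_mode)

lemma mode_cvec_vscale: "mode G n (cvec (a *\<^sub>v x)) v = smul (fls_const a) (mode G n (cvec x) v)"
proof (rule fock_linear_eq_at[of _ "\<lambda>v. smul (fls_const a) (mode G n (cvec x) v)"])
  show "mode G n (cvec (a *\<^sub>v x)) (ket l M) = smul (fls_const a) (mode G n (cvec x) (ket l M))" for l M
    by (simp add: mode_def cvec_def vscale_def fock.scale_sum_right sum_distrib_left mult_ac
        flip: fls_const_mult_const)
qed (rule fock_linear_mode fock_linear_smul[OF fock_linear_mode])+

text \<open>Every zero mode has eigenvalue 0 on weight 0, so the power of q is 1 there. Hence matrix
  elements on this weight space isolate the oscillators.\<close>

lemma lookup_qpow_weight_0: "Poly_Mapping.lookup (qpow G y v) (0, M) = Poly_Mapping.lookup v (0, M)"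
proof -
  have "Poly_Mapping.lookup (qpow G y v) (0, M) =
      (\<Sum>b\<in>Poly_Mapping.keys v. if b = (0, M) then Poly_Mapping.lookup v (0, M) else 0)"
    unfolding qpow_def diag_def lookup_lin
    by (rule sum.cong) (auto simp: lookup_ket bil_simps)
  then show ?thesis by (simp add: in_keys_iff)
qed

text \<open>The factor z removes the offset in the exponent \<open>- n - 1\<close> of a current,
  which pairs the n-th power of z with the mode of index \<open>- n\<close>.\<close>

lemma current_nonzero: "zmul 1 (current G y) (of_int n, 0) v = mode G (- n) (cvec y) v"
proof -
  have "of_int n - 1 = (of_int (n - 1) :: complex)" by simp
  then show ?thesis
    unfolding zmul_def current_def prod.case by (simp del: of_int_diff)
qed

lemma shift_diag_shift:
  "shift x (diag e (shift y v)) = shift (y + x) (diag (\<lambda>l. e (l + y)) v)"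
proof (rule fock_linear_eq_at[of "\<lambda>v. shift x (diag e (shift y v))" "\<lambda>v. shift (y + x) (diag (\<lambda>l. e (l + y)) v)"])
  have *: "shift x (smul a (ket l M)) = smul a (ket (l + x) M)" for x :: "'a vec" and a l M
    unfolding module_hom.scale[OF fock_linear_shift] by (simp add: shift_def)
  show "shift x (diag e (shift y (ket l M))) = shift (y + x) (diag (\<lambda>l. e (l + y)) (ket l M))" for l M
    by (simp add: shift_def[of y] diag_def * add.assoc)
qed (rule fock_linear_compose[OF fock_linear_shift] fock_linear_diag
      fock_linear_compose[OF fock_linear_diag fock_linear_shift])+

text \<open>Moving the right half of the shift through the power of z raises its exponent by half of
  \<open>bil G x x\<close>. This is the source of the extra power of z in the symmetric
  version.\<close>

lemma sym_ordered_zpow: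
  "sym_ordered x (zpow (zero_mode G x)) = zmul (bil G x x / 2) (left_ordered x (zpow (zero_mode G x)))"
proof (intro ext, clarify)
  fix r j v
  have half: "(1/2) *\<^sub>v x + (1/2) *\<^sub>v x = x"
    by (simp add: vscale_def fun_eq_iff)
  have "r = bil G x l + bil G x x / 2 \<longleftrightarrow> r - bil G x x / 2 = bil G x l" for l
    by (auto simp: algebra_simps)
  then show "sym_ordered x (zpow (zero_mode G x)) (r, j) v =
      zmul (bil G x x / 2) (left_ordered x (zpow (zero_mode G x))) (r, j) v"
    by (simp add: sym_ordered_def zmul_def left_ordered_def zpow_def zero_mode_def
        shift_diag_shift half bil_simps cong: if_cong)
qed

lemma vertex_zmul: "vertex G (zmul a Z) y = zmul a (vertex G Z y)"
  by (simp add: vertex_def zmul_def fun_eq_iff algebra_simps)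

lemma hbar_term_zmul: "hbar_term s (zmul a F) = zmul a (hbar_term s F)"
  by (simp add: hbar_term_def zmul_def fun_eq_iff)

lemma hbar_expandable_zmul: "hbar_expandable F \<Longrightarrow> hbar_expandable (zmul a F)"
  by (auto simp: hbar_expandable_def hbar_term_zmul) (auto simp: zmul_def fun_eq_iff)

text \<open>Agreement in all orders below 1 includes the negative ones, so it gives regularity as
  well as the value.\<close>

lemma fock_lim_zero_mode_operator:
  assumes "fock_linear A" "eq_mod_hbar 1 (const_field A) (const_field (shift x))" "fock_lim v w"
  shows "fock_lim (A v) (shift x w)"
proof -
  have "fock_lim (lin (\<lambda>l M. A (ket l M)) v) (lin (\<lambda>l M. ket (l + x) M) w)"
  proof (rule fock_lim_lin[OF assms(3)])
    fix l M
    have eq: "fls_nth (Poly_Mapping.lookup (A (ket l M)) b) s =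
        fls_nth (Poly_Mapping.lookup (ket (l + x) M) b) s" if "s < 1" for b s
      using eq_mod_hbarD[OF assms(2) that, of "(0, 0)" l M b] by (simp add: const_field_def shift_def)
    show "fock_lim (A (ket l M)) (ket (l + x) M)"
      unfolding fock_lim_def fls_lim_iff using eq by (auto simp: lookup_ket intro!: fls_eqI)
  qed
  then show ?thesis
    by (simp add: shift_def flip: fock_linear_eq_lin[OF assms(1)])
qed

theorem proposition5p6:
  fixes N :: nat and k :: complex
    and G :: "'g::finite \<Rightarrow> 'g \<Rightarrow> complex"
    and c d :: "'g vec" and \<alpha> \<alpha>' :: "nat \<Rightarrow> 'g vec"
    and p q :: "nat \<Rightarrow> 'g vec"
    and x :: "'g modes"
    and S0 :: "nat \<Rightarrow> 'g fock \<Rightarrow> 'g fock" and s0 :: "nat \<Rightarrow> 'g vec \<Rightarrow> complex fps"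
  assumes "N \<ge> 2" and "k \<noteq> - of_nat N"
    and "sub_fields G N k c d \<alpha>"
    and "\<alpha>' = tilde N k c \<alpha>"
    and "c = - q 1 + q 2" and "d = - q 1 - q 2" and "c = - p 1 - p 2" and "d = - p 1 + p 2"
    and "seed_relations G N k x" and "central_zero G N x"
    and "eq_mod_hbar 1 (X_field G N p q \<alpha>' x 0) (exp_field G c)"
    and "eq_mod_hbar 2 (X_field G N p q \<alpha>' x 1)
           (- const_field (\<lambda>v. v) - fscale (fls_X * fls_const (1/2)) (zmul 1 (current G c + current G d)))"
    and "\<And>i. i \<in> {2..N} \<Longrightarrow> eq_mod_hbar 2 (X_field G N p q \<alpha>' x i)
           (const_field (\<lambda>v. v) + fscale fls_X (zmul 1 (current G (\<alpha>' (i - 1)))))"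
    and "eq_mod_hbar 1 (X_field G N p q \<alpha>' x (N + 1)) (exp_field G (- c))"
    and "\<And>i. i \<in> {2..N} \<Longrightarrow> zero_mode_operator G (S0 i)"
    and "\<And>i. i \<in> {2..N} \<Longrightarrow> eq_mod_hbar 1 (const_field (S0 i))
           (const_field (shift ((- 1 / (of_nat N + k)) *\<^sub>v \<alpha>' (i - 1))))"
    and "\<And>i l. i \<in> {2..N} \<Longrightarrow> fps_nth (s0 i l) 0 = bil G (\<alpha>' (i - 1)) l / (of_nat N + k)"
  shows "(let \<Psi> = Psi_star G (left_ordered (- q 1) (zpow (zero_mode G (- p 1)))) x in
            hbar_expandable \<Psi> \<and> hbar_term 0 \<Psi> = Psi_FMS G c d \<and>
            Psi_FMS G c d = exp_field G ((1/2) *\<^sub>v c + (1/2) *\<^sub>v d)) \<and>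
         (let \<Psi> = Psi_star G (sym_ordered (- q 1) (zpow (zero_mode G (- p 1)))) x in
            hbar_expandable \<Psi> \<and> hbar_term 0 \<Psi> = zmul (1/2) (Psi_FMS G c d)) \<and>
         (\<forall>i\<in>{2..N}. let S = S_minus G N k (S0 i) (s0 i) x i in
            hbar_expandable S \<and> hbar_term 0 S = S_sub G N k c \<alpha> (i - 1) \<and>
            S_sub G N k c \<alpha> (i - 1) = exp_field G ((- 1 / (of_nat N + k)) *\<^sub>v \<alpha>' (i - 1)))"
proof -
  \<comment> \<open>Solving the identifications of \<open>c\<close> and \<open>d\<close> for the
    zero modes shows that \<open>- q 1\<close> and \<open>- p 1\<close> are both this vector, so
    shift and exponent fit together as in \<open>exp_field\<close>.\<close>
  define a where "a = (1/2) *\<^sub>v c + (1/2) *\<^sub>v d"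
  have q1: "- q 1 = a"
    unfolding a_def by (rule ext, subst assms(5), subst assms(6)) (simp add: vscale_def field_simps)
  have p1: "- p 1 = a"
    unfolding a_def by (rule ext, subst assms(7), subst assms(8)) (simp add: vscale_def field_simps)
  have Nk: "of_nat N + k \<noteq> 0"
    using assms(2) by (metis add_eq_0_iff)
  \<comment> \<open>Both cross terms contribute \<open>2 / 4\<close>; the second one uses the
    symmetry of \<open>G\<close>.\<close>
  have aa: "bil G a a = 1"
  proof -
    have "bil G d c = bil G c d"
    proof -
      have "bil G d c = (\<Sum>g\<in>UNIV. \<Sum>h\<in>UNIV. c g * G g h * d h)"
        unfolding bil_def using assms(3)
        by (subst sum.swap) (auto simp: sub_fields_def mult_ac intro!: sum.cong)
      then show ?thesis by (simp add: bil_def)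
    qed
    then show ?thesis
      using assms(3) by (simp add: a_def bil_simps sub_fields_def)
  qed

  have X1: "eq_mod_hbar 2 (vertex G (const_field (\<lambda>v. - qpow G ((- 2) *\<^sub>v p 1) v)) (\<lambda>n. fvec (x 1 n)))
      (- const_field (\<lambda>v. v) - fscale (fls_X * fls_const (1/2)) (zmul 1 (current G c + current G d)))"
    using assms(12) by (simp add: X_field_def X_zero_def)
  have linq: "fock_linear (qpow G y)" for y
    unfolding qpow_def by (rule fock_linear_diag)
  then have linq': "fock_linear (\<lambda>v. - qpow G ((- 2) *\<^sub>v p 1) v)"
    by (simp add: module_hom_iff)
  \<comment> \<open>Here \<epsilon> = -1, since the expansion starts with -1 and its order \<hbar>
    is - z a(z).\<close>
  have H1: "(- const_field (\<lambda>v. v) - fscale (fls_X * fls_const (1/2)) (zmul 1 (current G c + current G d)))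
      (of_int n, 0) (ket 0 M) = smul (fls_X * fls_const (- 1)) (mode G (- n) (cvec a) (ket 0 M))"
    if "n \<noteq> 0" for n M
  proof -
    have "zmul 1 (current G c + current G d) (of_int n, 0) (ket 0 M) = mode G (- n) (cvec (c + d)) (ket 0 M)"
      using current_nonzero[of G c n "ket 0 M"] current_nonzero[of G d n "ket 0 M"]
      by (simp add: zmul_def flip: mode_cvec_add)
    moreover have "a = (1/2) *\<^sub>v (c + d)"
      by (simp add: a_def vscale_def fun_eq_iff algebra_simps)
    ultimately show ?thesis
      using that by (simp add: const_field_def fscale_def mode_cvec_vscale)
  qed
  note modes1 = first_order_modes[OF X1 linq' _ _ H1]
  \<comment> \<open>The denominator is negated to absorb the sign in \<open>Psi_star\<close>. Its
    linear coefficient is \<open>- n\<close>, so \<delta> = -1 and the limiting vector is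
    \<open>a\<close>.\<close>
  have "modes_lim G (\<lambda>n g. fvec (x 1 n) g / fps_to_fls (- (qn n - qn (- n))))
     (\<lambda>n. cvec ((- 1 / of_int n) *\<^sub>v ((- 1 / (- 1)) *\<^sub>v a)))"
    by (rule modes_lim_divide, (rule modes1; simp add: lookup_qpow_weight_0)+)
       (auto simp: qn_def)
  moreover have "(\<lambda>n g. fvec (x 1 n) g / fps_to_fls (- (qn n - qn (- n)))) =
      (\<lambda>n g. - (fvec (x 1 n) g / fps_to_fls (qn n - qn (- n))))"
    by (simp only: fps_to_fls_uminus divide_minus_right)
  moreover have "1 *\<^sub>v a = a" by (simp add: vscale_def)
  ultimately have lim1: "modes_lim G (\<lambda>n g. - (fvec (x 1 n) g / fps_to_fls (qn n - qn (- n))))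
     (\<lambda>n. cvec ((- 1 / of_int n) *\<^sub>v a))" by simp
  have Psi: "hbar_expandable (Psi_star G (left_ordered a (zpow (zero_mode G a))) x) \<and>
      hbar_term 0 (Psi_star G (left_ordered a (zpow (zero_mode G a))) x) = Psi_FMS G c d"
    unfolding Psi_star_def left_ordered_def Psi_FMS_def a_def [symmetric]
    by (rule vertex_leading_term[OF lim1 _ fock_linear_shift fock_lim_shift])
       (simp_all add: zero_mode_def)
  \<comment> \<open>The exponent is half of the norm 1 of \<open>a\<close>. Multiplication by a
    fixed power of z commutes with \<open>hbar_term\<close>, so the symmetric case reduces to the
    left-ordered one.\<close>
  have Psi_sym: "Psi_star G (sym_ordered a (zpow (zero_mode G a))) x =
      zmul (1/2) (Psi_star G (left_ordered a (zpow (zero_mode G a))) x)"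
    by (simp add: Psi_star_def sym_ordered_zpow vertex_zmul aa)

  have S: "hbar_expandable (S_minus G N k (S0 i) (s0 i) x i) \<and>
      hbar_term 0 (S_minus G N k (S0 i) (s0 i) x i) = exp_field G ((- 1 / (of_nat N + k)) *\<^sub>v \<alpha>' (i - 1))"
    if i: "i \<in> {2..N}" for i
  proof -
    have Xi: "eq_mod_hbar 2 (vertex G (const_field (qpow G (2 *\<^sub>v \<alpha>' (i - 1)))) (\<lambda>n. fvec (x i n)))
        (const_field (\<lambda>v. v) + fscale fls_X (zmul 1 (current G (\<alpha>' (i - 1)))))"
      using assms(13)[OF i] i by (simp add: X_field_def X_zero_def)
    have Hi: "(const_field (\<lambda>v. v) + fscale fls_X (zmul 1 (current G (\<alpha>' (i - 1))))) (of_int n, 0) (ket 0 M) =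
        smul (fls_X * fls_const 1) (mode G (- n) (cvec (\<alpha>' (i - 1))) (ket 0 M))"
      if "n \<noteq> 0" for n M
      using that by (simp add: const_field_def fscale_def current_nonzero)
    note modesi = first_order_modes[OF Xi linq _ _ Hi]
    \<comment> \<open>After negation the denominator has linear coefficient
      \<open>(N + k) n\<close>, so \<delta> = N + k, which is nonzero away from the critical
      level.\<close>
    have "modes_lim G (\<lambda>n g. fvec (x i n) g / fps_to_fls (- (sigma_n N k n - sigma_n N k (- n))))
       (\<lambda>n. cvec ((- 1 / of_int n) *\<^sub>v ((- 1 / (of_nat N + k)) *\<^sub>v \<alpha>' (i - 1))))"
      by (rule modes_lim_divide, (rule modesi; simp add: lookup_qpow_weight_0)+)
         (use Nk in \<open>auto simp: sigma_n_def field_simps\<close>)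
    moreover have "(\<lambda>n g. fvec (x i n) g / fps_to_fls (- (sigma_n N k n - sigma_n N k (- n)))) =
        (\<lambda>n g. - s_modes N k x i n g)"
      by (simp only: s_modes_def fps_to_fls_uminus divide_minus_right)
    ultimately have limi: "modes_lim G (\<lambda>n g. - s_modes N k x i n g)
       (\<lambda>n. cvec ((- 1 / of_int n) *\<^sub>v ((- 1 / (of_nat N + k)) *\<^sub>v \<alpha>' (i - 1))))"
      by simp
    have lin: "fock_linear (S0 i)"
      using assms(15)[OF i] unfolding zero_mode_operator_def by (intro fock_linearI) auto
    show ?thesis
      unfolding S_minus_def
      by (rule vertex_leading_term[OF limi _ lin fock_lim_zero_mode_operator[OF lin assms(16)[OF i]]])
         (simp_all add: assms(17)[OF i] bil_simps)
  qed
  have S_sub: "S_sub G N k c \<alpha> (i - 1) = exp_field G ((- 1 / (of_nat N + k)) *\<^sub>v \<alpha>' (i - 1))" for i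
  proof -
    \<comment> \<open>The summand \<open>c\<close> of the first screening current is exactly what
      the shift in \<open>tilde\<close> produces after division by \<open>- (N + k)\<close>.\<close>
    have "(- 1 / (of_nat N + k)) *\<^sub>v \<alpha> 1 + c = (- 1 / (of_nat N + k)) *\<^sub>v (\<alpha> 1 - (of_nat N + k) *\<^sub>v c)"
      using Nk by (simp add: vscale_def fun_eq_iff field_simps)
    then show ?thesis by (simp add: S_sub_def assms(4) tilde_def)
  qed
  show ?thesis
    unfolding Let_def q1 p1 Psi_sym
    using Psi S S_sub by (auto simp: hbar_expandable_zmul hbar_term_zmul Psi_FMS_def a_def)
qed

end
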